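(* Let $T\subset\mathbb{R}^n$ be a hyperplane perpendicular to $\mathbf{e}$, let $\Sigma$ be the open half-space on one side of $T$, and let $\tilde x$ denote the reflection of $x$ with respect to $T$. Let $\Omega$ be a bounded open set in $\Sigma$. Assume that $w\in\mathcal{L}_s(\mathbb{R}^n)\cap C^{1,1}_{loc}(\Omega)$ is lower semi-continuous on $\overline{\Omega}$ and satisfies $$\begin{cases}\mathbf{F_s}w(x)-c(x)w(x)\le 0 & \text{at points } x\in\Omega \text{ where } w(x)<0,\\ w(x)\ge 0 & \text{in } \Sigma\setminus\Omega,\\ w(\tilde x)=-w(x) & \text{in } \Sigma,\end{cases}$$ where $c(x)\ge 0$ for every $x\in\{x\in\Omega : w(x)<0\}$. Then $w(x)\ge 0$ in $\Omega$. Furthermore, assume in addition that $\mathbf{F_s}w(x)\le 0$ at points $x\in\Omega$ where $w(x)=0$. Then either $w>0$ in $\Omega$ or $w=0$ almost everywhere in $\mathbb{R}^n$. These conclusions hold for unbounded open sets $\Omega\subseteq\Sigma$ if one further assumes that $\liminf_{|x|\to\infty}w(x)\ge 0$.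
   Context: Let $n\ge 2$, $0<s<1$ and $0<\theta\le\Theta<\infty$. $\mathcal{L}_s(\mathbb{R}^n)$ is the set of functions $u:\mathbb{R}^n\to\mathbb{R}$ with $\int_{\mathbb{R}^n}\frac{|u(x)|}{1+|x|^{n+2s}}\,dx<+\infty$. $C^{1,1}_{loc}(\Omega)$ denotes functions that are $C^1$ with locally Lipschitz gradient in $\Omega$. Fix a unit vector $\mathbf{e}\in\mathbb{R}^n$. For $u\in\mathcal{L}_s(\mathbb{R}^n)$ that is $C^{1,1}$ near $x$, $$\mathbf{F_s}u(x):=\inf\left\{P.V.\int_{\mathbb{R}^n}\frac{u(y)-u(x)}{|A^{-1}(y-x)|^{n+2s}}\,dy \;:\; A \text{ a real symmetric } n\times n \text{ matrix},\ \theta I\le A\le\Theta I,\ \mathbf{e} \text{ is an eigenvector of } A\right\}.$$ P.V. denotes the Cauchy principal value. *)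

theory Defs
  imports "HOL-Analysis.Analysis"
begin

definition Ls :: "real \<Rightarrow> (real ^ 'n \<Rightarrow> real) set" where
  "Ls s = {u. u \<in> borel_measurable lebesgue \<and>
     integrable lebesgue (\<lambda>x. \<bar>u x\<bar> / (1 + norm x powr (real CARD('n) + 2 * s)))}"

text \<open>Continuity of the gradient is implied by its local Lipschitz continuity. The set
  \<open>\<Omega>\<close> is meant to be open.\<close>

definition C11_loc :: "(real ^ 'n) set \<Rightarrow> (real ^ 'n \<Rightarrow> real) set" where
  "C11_loc \<Omega> = {u. \<exists>Du. (\<forall>x\<in>\<Omega>. GDERIV u x :> Du x) \<and>
     (\<forall>x\<in>\<Omega>. \<exists>r>0. \<exists>L. L-lipschitz_on (ball x r \<inter> \<Omega>) Du)}"

text \<open>The singularity is removed by Euclidean balls centred at \<open>x\<close>. This is a real limit,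
  hence meaningful only where it exists.\<close>

definition pv_integral :: "real ^ 'n \<Rightarrow> (real ^ 'n \<Rightarrow> real) \<Rightarrow> real" where
  "pv_integral x f = Lim (at_right 0) (\<lambda>\<epsilon>. LINT y:- ball x \<epsilon>|lebesgue. f y)"

definition loewner_le :: "real ^ 'n ^ 'n \<Rightarrow> real ^ 'n ^ 'n \<Rightarrow> bool" where
  "loewner_le A B \<longleftrightarrow> (\<forall>v. v \<bullet> (A *v v) \<le> v \<bullet> (B *v v))"

definition is_eigenvector :: "real ^ 'n ^ 'n \<Rightarrow> real ^ 'n \<Rightarrow> bool" where
  "is_eigenvector A v \<longleftrightarrow> v \<noteq> 0 \<and> (\<exists>\<mu>. A *v v = \<mu> *\<^sub>R v)"

definition admissible :: "real \<Rightarrow> real \<Rightarrow> real ^ 'n \<Rightarrow> (real ^ 'n ^ 'n) set" where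
  "admissible \<theta> \<Theta> e = {A. transpose A = A \<and> loewner_le (mat \<theta>) A \<and> loewner_le A (mat \<Theta>) \<and>
     is_eigenvector A e}"

text \<open>For \<open>u \<in> Ls s\<close> of class \<open>C11\<close> near \<open>x\<close> every principal value below exists and the
  infimum is taken over a nonempty set of reals that is bounded below; elsewhere the value
  is unspecified.\<close>

definition Fs :: "real \<Rightarrow> real \<Rightarrow> real \<Rightarrow> real ^ 'n \<Rightarrow> (real ^ 'n \<Rightarrow> real) \<Rightarrow> real ^ 'n \<Rightarrow> real" where
  "Fs s \<theta> \<Theta> e u x = (INF A\<in>admissible \<theta> \<Theta> e. pv_integral x
     (\<lambda>y. (u y - u x) / norm (matrix_inv A *v (y - x)) powr (real CARD('n) + 2 * s)))"

text \<open>Reflection in the hyperplane \<open>{x. x \<bullet> e = t}\<close>, for \<open>norm e = 1\<close>.\<close>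

definition reflect :: "real ^ 'n \<Rightarrow> real \<Rightarrow> real ^ 'n \<Rightarrow> real ^ 'n" where
  "reflect e t x = x - (2 * (x \<bullet> e - t)) *\<^sub>R e"

definition lsc_on :: "'a::topological_space set \<Rightarrow> ('a \<Rightarrow> real) \<Rightarrow> bool" where
  "lsc_on S f \<longleftrightarrow> (\<forall>x\<in>S. \<forall>a. a < f x \<longrightarrow> (\<forall>\<^sub>F y in at x within S. a < f y))"

end

theory Submission
  imports Defs
begin

text \<open>For an admissible \<open>A\<close> the vector \<open>e\<close> is an eigenvector of \<open>A\<close>, so the kernel
  \<open>K v = \<bar>A\<^sup>-\<^sup>1 v\<bar> powr - (n + 2 s)\<close> satisfies \<open>K (y' - x) < K (y - x)\<close> when \<open>x\<close>, \<open>y\<close> lie in \<open>\<Sigma>\<close>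
  and \<open>y'\<close> is the reflection of \<open>y\<close>. By antisymmetry, the principal value at \<open>x\<close> is the limit of the
  integral of \<open>(w y - w x) (K (y - x) - K (y' - x))\<close> over \<open>\<Sigma>\<close> without a small ball around \<open>x\<close>, minus
  \<open>2 w x\<close> times the integral of \<open>K (y' - x)\<close> over \<open>\<Sigma>\<close>.

  The values of \<open>w\<close> on the hyperplane are unrestricted, so a negative infimum over \<open>\<Omega>\<close> need not be attained
  inside. At an almost minimal point at distance \<open>D\<close> from the hyperplane, a small quadratic perturbation
  on the scale \<open>D\<close> creates an interior minimum \<open>z\<close>. There the first integral is at least
  \<open>- o(1) D powr (- 2 s)\<close>, while the last term is at least a constant times \<open>D powr (- 2 s)\<close>, uniformly in
  \<open>A\<close>; hence the infimum over \<open>A\<close> is positive at \<open>z\<close>, a contradiction. At an interior zero of a nonnegative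
  \<open>w\<close> only the first integral remains, and its integrand dominates \<open>w\<close> times a positive weight independent
  of \<open>A\<close>, so \<open>w\<close> vanishes almost everywhere.\<close>

section \<open>Isometries and Lebesgue measure\<close>

lemma nn_integral_lborel_translate:
  fixes f :: "'a::euclidean_space \<Rightarrow> ennreal"
  assumes [measurable]: "f \<in> borel_measurable borel"
  shows "(\<integral>\<^sup>+x. f (a + x) \<partial>lborel) = (\<integral>\<^sup>+x. f x \<partial>lborel)"
proof -
  have "(\<integral>\<^sup>+x. f x \<partial>distr lborel borel ((+) a)) = (\<integral>\<^sup>+x. f (a + x) \<partial>lborel)"
    by (subst nn_integral_distr) auto
  then show ?thesis by (simp add: lborel_distr_plus)
qed

text \<open>Convolving with the indicator of the unit ball, which is invariant under \<open>f\<close>, identifies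
  the translation-invariant image measure with Lebesgue measure.\<close>

lemma lborel_distr_orthogonal:
  fixes f :: "'a::euclidean_space \<Rightarrow> 'a"
  assumes f: "orthogonal_transformation f"
  shows "distr lborel borel f = lborel"
proof (rule measure_eqI)
  have lin: "linear f" using f by (rule orthogonal_transformation_linear)
  have [measurable]: "f \<in> borel_measurable borel"
    by (intro borel_measurable_continuous_onI linear_continuous_on linear_conv_bounded_linear[THEN iffD1] lin)
  show "sets (distr lborel borel f) = sets lborel" by simp
  fix A assume "A \<in> sets (distr lborel borel f)"
  then have A[measurable]: "A \<in> sets borel" by simp
  define F where "F = (indicator A :: 'a \<Rightarrow> ennreal)"
  define g where "g = (indicator (ball 0 1) :: 'a \<Rightarrow> ennreal)"
  have [measurable]: "F \<in> borel_measurable borel" "g \<in> borel_measurable borel"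
    by (simp_all add: F_def g_def borel_measurable_indicator)
  obtain f' where f': "\<And>y. f (f' y) = y"
    using orthogonal_transformation_surj[OF f] by (metis surj_def)
  \<comment> \<open>By surjectivity \<open>y = f (f' y)\<close>, so a shift after \<open>f\<close>
    is a shift by \<open>f' y\<close> before it, and translation invariance of \<open>lborel\<close>
    passes to the image measure.\<close>
  have shift: "(\<integral>\<^sup>+x. h (y + f x) \<partial>lborel) = (\<integral>\<^sup>+x. h (f x) \<partial>lborel)"
    if [measurable]: "h \<in> borel_measurable borel" for h :: "'a \<Rightarrow> ennreal" and y
  proof -
    have "(\<integral>\<^sup>+x. h (f (f' y + x)) \<partial>lborel) = (\<integral>\<^sup>+x. h (f x) \<partial>lborel)"
      by (rule nn_integral_lborel_translate) measurable
    then show ?thesis by (simp add: linear_add[OF lin] f')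
  qed
  have "(\<integral>\<^sup>+x. F (f x) \<partial>lborel) * (\<integral>\<^sup>+y. g y \<partial>lborel) =
      (\<integral>\<^sup>+y. \<integral>\<^sup>+x. F (y + f x) * g y \<partial>lborel \<partial>lborel)"
    by (simp add: nn_integral_multc shift nn_integral_cmult)
  also have "\<dots> = (\<integral>\<^sup>+x. \<integral>\<^sup>+y. F (y + f x) * g y \<partial>lborel \<partial>lborel)"
    by (rule lborel_pair.Fubini') measurable
  also have "\<dots> = (\<integral>\<^sup>+x. \<integral>\<^sup>+y. F y * g (y - f x) \<partial>lborel \<partial>lborel)"
  proof (rule nn_integral_cong)
    fix x
    show "(\<integral>\<^sup>+y. F (y + f x) * g y \<partial>lborel) = (\<integral>\<^sup>+y. F y * g (y - f x) \<partial>lborel)"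
      using nn_integral_lborel_translate[of "\<lambda>y. F y * g (y - f x)" "f x"] by (simp add: add.commute)
  qed
  also have "\<dots> = (\<integral>\<^sup>+y. \<integral>\<^sup>+x. F y * g (y - f x) \<partial>lborel \<partial>lborel)"
    by (rule lborel_pair.Fubini') measurable
  also have "\<dots> = (\<integral>\<^sup>+y. F y * (\<integral>\<^sup>+x. g (- f x) \<partial>lborel) \<partial>lborel)"
  proof (intro nn_integral_cong)
    fix y
    have "(\<integral>\<^sup>+x. g (- (- y + f x)) \<partial>lborel) = (\<integral>\<^sup>+x. g (- f x) \<partial>lborel)"
      by (rule shift[of "\<lambda>z. g (- z)"]) measurable
    then show "(\<integral>\<^sup>+x. F y * g (y - f x) \<partial>lborel) = F y * (\<integral>\<^sup>+x. g (- f x) \<partial>lborel)"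
      by (simp add: nn_integral_cmult)
  qed
  also have "\<dots> = (\<integral>\<^sup>+y. F y \<partial>lborel) * (\<integral>\<^sup>+x. g x \<partial>lborel)"
    by (simp add: nn_integral_multc g_def indicator_def orthogonal_transformation_norm[OF f])
  finally have eq: "(\<integral>\<^sup>+x. F (f x) \<partial>lborel) * (\<integral>\<^sup>+y. g y \<partial>lborel) =
      (\<integral>\<^sup>+y. F y \<partial>lborel) * (\<integral>\<^sup>+x. g x \<partial>lborel)" .
  \<comment> \<open>The unit ball has positive finite volume, so this factor can be cancelled from
    \<open>eq\<close> in \<open>ennreal\<close>.\<close>
  have gb: "(\<integral>\<^sup>+x. g x \<partial>lborel) = ennreal (unit_ball_vol (real DIM('a)))"
    by (simp add: g_def emeasure_ball)
  have "unit_ball_vol (real DIM('a)) \<noteq> 0"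
    by (rule less_imp_neq[symmetric], rule unit_ball_vol_pos) simp
  then have "(\<integral>\<^sup>+x. F (f x) \<partial>lborel) = (\<integral>\<^sup>+y. F y \<partial>lborel)"
    using eq unfolding gb by (subst (asm) (1 2) mult.commute, subst (asm) ennreal_mult_cancel_left) auto
  then have "(\<integral>\<^sup>+x. F x \<partial>distr lborel borel f) = (\<integral>\<^sup>+y. F y \<partial>lborel)"
    by (simp add: nn_integral_distr)
  then show "emeasure (distr lborel borel f) A = emeasure lborel A"
    by (simp add: F_def)
qed

text \<open>Passing to the completion requires preimages of null sets to be null; this holds because
  the image of the uncompleted measure is \<open>lborel\<close> itself.\<close>

lemma lebesgue_measure_preserving:
  fixes R :: "'a::euclidean_space \<Rightarrow> 'a"
  assumes R[measurable]: "R \<in> borel_measurable borel" and inv: "distr lborel borel R = lborel"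
  shows "R \<in> lebesgue \<rightarrow>\<^sub>M lebesgue" and "distr lebesgue lebesgue R = lebesgue"
proof -
  have R1: "R \<in> lborel \<rightarrow>\<^sub>M lborel" by simp
  then have R2: "R \<in> lebesgue \<rightarrow>\<^sub>M lborel" by (rule measurable_completion)
  have d: "distr lebesgue lborel R = lborel"
    using distr_completion[OF R1] inv by (simp cong: distr_cong)
  then have n: "null_sets lborel = null_sets (distr lebesgue lborel R)" by simp
  show "R \<in> lebesgue \<rightarrow>\<^sub>M lebesgue"
    by (rule completion.measurable_completion2[OF R2]) (simp add: n)
  have "completion (distr lebesgue lborel R) = distr lebesgue lebesgue R"
    by (rule completion.completion_distr_eq[OF R2 n[symmetric]])
  then show "distr lebesgue lebesgue R = lebesgue" by (simp add: d)
qed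

section \<open>Integrals of powers of the norm\<close>

text \<open>On the shell of outer radius \<open>r * q ^ k\<close> the integrand is at most a
  constant times \<open>(r * q ^ k) powr p\<close>, and the shell has volume at most a constant
  times \<open>(r * q ^ k) powr n\<close>. Summing over \<open>k\<close> gives a geometric series of
  ratio \<open>q powr (p + n)\<close>. Leaving \<open>q\<close> free treats balls and their
  complements together.\<close>

lemma nn_integral_norm_powr_dyadic:
  fixes S :: "'a::euclidean_space set" and p q r :: real
  defines "n \<equiv> real DIM('a)"
  assumes r: "r > 0" and q: "q > 0" "q powr (p + n) < 1"
    and cov: "\<And>v. v \<in> S \<Longrightarrow> v \<noteq> 0 \<Longrightarrow> \<exists>k. r * q ^ k / 2 \<le> norm v \<and> norm v \<le> r * q ^ k"
  shows "(\<integral>\<^sup>+v. ennreal (norm v powr p * indicator S v) \<partial>lborel)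
    \<le> ennreal (2 powr \<bar>p\<bar> * unit_ball_vol n / (1 - q powr (p + n)) * r powr (p + n))"
proof -
  \<comment> \<open>\<open>a k\<close> bounds the integrand on the \<open>k\<close>-th shell for
    either sign of \<open>p\<close>; \<open>b k\<close> is \<open>a k\<close> times the volume of
    the ball enclosing the shell.\<close>
  define a where "a k = 2 powr \<bar>p\<bar> * (r * q ^ k) powr p" for k
  define b where "b k = 2 powr \<bar>p\<bar> * unit_ball_vol n * r powr (p + n) * (q powr (p + n)) ^ k" for k
  have pw: "ennreal (norm v powr p * indicator S v) \<le> (\<Sum>k. ennreal (a k) * indicator (cball 0 (r * q ^ k)) v)" for v
  proof (cases "v \<in> S \<and> v \<noteq> 0")
    case True
    then obtain k where k: "r * q ^ k / 2 \<le> norm v" "norm v \<le> r * q ^ k"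
      using cov by blast
    have pos: "r * q ^ k > 0" using r q by simp
    have "norm v powr p \<le> a k"
    proof (cases "p \<ge> 0")
      case True
      have "norm v powr p \<le> (r * q ^ k) powr p" by (rule powr_mono2) (use True k in auto)
      also have "\<dots> \<le> 2 powr \<bar>p\<bar> * (r * q ^ k) powr p" using mult_right_mono[of 1 "2 powr \<bar>p\<bar>" "(r * q ^ k) powr p"] by (simp add: ge_one_powr_ge_zero)
      finally show ?thesis by (simp add: a_def)
    next
      case False
      have "norm v powr p \<le> (r * q ^ k / 2) powr p" by (rule powr_mono2') (use False k pos in auto)
      also have "\<dots> = a k" using False pos by (simp add: a_def powr_divide powr_minus divide_simps)
      finally show ?thesis .
    qed
    then have "ennreal (norm v powr p * indicator S v) \<le> ennreal (a k) * indicator (cball 0 (r * q ^ k)) v"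
      using True k by (auto intro: ennreal_leI)
    also have "\<dots> \<le> (\<Sum>k. ennreal (a k) * indicator (cball 0 (r * q ^ k)) v)"
    proof -
      define g where "g j = ennreal (a j) * indicator (cball 0 (r * q ^ j)) v" for j
      have "sum g {k} \<le> suminf g" by (rule sum_le_suminf) auto
      then have "g k \<le> suminf g" by simp
      then show ?thesis unfolding g_def[abs_def] .
    qed
    finally show ?thesis .
  qed auto
  have em: "ennreal (a k) * emeasure lborel (cball (0::'a) (r * q ^ k)) = ennreal (b k)" for k
  proof -
    have rq: "r * q ^ k > 0" using r q by simp
    have "a k * (unit_ball_vol n * (r * q ^ k) ^ DIM('a)) =
        2 powr \<bar>p\<bar> * unit_ball_vol n * ((r * q ^ k) powr p * (r * q ^ k) powr n)"
      using rq by (simp add: a_def n_def powr_realpow)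
    also have "(r * q ^ k) powr p * (r * q ^ k) powr n = r powr (p + n) * (q powr (p + n)) ^ k"
    proof -
      have "(q ^ k) powr (p + n) = (q powr (p + n)) ^ k"
        using q by (simp add: powr_powr powr_power mult.commute flip: powr_realpow)
      then show ?thesis using r q by (simp only: powr_add[symmetric]) (simp add: powr_mult)
    qed
    finally have "a k * (unit_ball_vol n * (r * q ^ k) ^ DIM('a)) = b k" by (simp add: b_def)
    then show ?thesis using rq by (subst emeasure_cball) (auto simp: ennreal_mult[symmetric] a_def n_def)
  qed
  have bs: "b sums (2 powr \<bar>p\<bar> * unit_ball_vol n / (1 - q powr (p + n)) * r powr (p + n))"
    using sums_mult[OF geometric_sums[of "q powr (p + n)"], of "2 powr \<bar>p\<bar> * unit_ball_vol n * r powr (p + n)"] q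
    by (simp add: b_def[abs_def] mult_ac)
  have "(\<integral>\<^sup>+v. ennreal (norm v powr p * indicator S v) \<partial>lborel) \<le>
      (\<integral>\<^sup>+v. (\<Sum>k. ennreal (a k) * indicator (cball 0 (r * q ^ k)) v) \<partial>(lborel::'a measure))"
    by (intro nn_integral_mono pw)
  also have "\<dots> = (\<Sum>k. \<integral>\<^sup>+v. ennreal (a k) * indicator (cball 0 (r * q ^ k)) v \<partial>(lborel::'a measure))"
    by (intro nn_integral_suminf borel_measurable_times_ennreal borel_measurable_indicator
      borel_measurable_const) simp
  also have "\<dots> = (\<Sum>k. ennreal (b k))"
    by (simp add: nn_integral_cmult_indicator em)
  also have "\<dots> = ennreal (2 powr \<bar>p\<bar> * unit_ball_vol n / (1 - q powr (p + n)) * r powr (p + n))"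
    by (rule suminf_ennreal_eq[OF _ bs]) (simp add: b_def n_def)
  finally show ?thesis .
qed

text \<open>The point is that \<open>C\<close> does not depend on \<open>r\<close>. The factor
  \<open>m\<close> normalises the shells: it is 1 for balls and 2 for complements, whose innermost
  shell has outer radius \<open>2 * r\<close>.\<close>

lemma norm_powr_integral_dyadic:
  fixes S :: "real \<Rightarrow> 'a::euclidean_space set" and p q m :: real
  assumes q: "q > 0" "q powr (p + real DIM('a)) < 1" and m: "m > 0"
    and S: "\<And>r. S r \<in> sets borel"
    and cov: "\<And>r v. r > 0 \<Longrightarrow> v \<in> S r \<Longrightarrow> v \<noteq> 0 \<Longrightarrow>
      \<exists>k. m * r * q ^ k / 2 \<le> norm v \<and> norm v \<le> m * r * q ^ k"
  obtains C where "C \<ge> 0" "\<And>r. r > 0 \<Longrightarrow> set_integrable lebesgue (S r) (\<lambda>v. norm v powr p)"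
    "\<And>r. r > 0 \<Longrightarrow> (LINT v:S r|lebesgue. norm v powr p) \<le> C * r powr (p + real DIM('a))"
proof
  define n where "n = real DIM('a)"
  define D where "D = 2 powr \<bar>p\<bar> * unit_ball_vol n / (1 - q powr (p + n))"
  have D: "D \<ge> 0" using q by (auto simp: D_def n_def)
  show "D * m powr (p + n) \<ge> 0" using D by simp
  fix r :: real assume r: "r > 0"
  have "(\<integral>\<^sup>+v. ennreal (norm v powr p * indicator (S r) v) \<partial>lborel)
      \<le> ennreal (D * (m * r) powr (p + n))"
    unfolding D_def n_def by (rule nn_integral_norm_powr_dyadic) (use q m r cov in auto)
  also have "D * (m * r) powr (p + n) = D * m powr (p + n) * r powr (p + n)"
    using m r by (simp add: powr_mult)
  finally have *: "(\<integral>\<^sup>+v. ennreal (norm v powr p * indicator (S r) v) \<partial>lborel)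
      \<le> ennreal (D * m powr (p + n) * r powr (p + n))" .
  have [measurable]: "S r \<in> sets borel" by (rule S)
  have meas: "(\<lambda>v. norm v powr p * indicator (S r) v) \<in> borel_measurable lborel" by measurable
  have int: "integrable lborel (\<lambda>v. norm v powr p * indicator (S r) v)"
    using * meas by (intro integrableI_bounded) (auto simp: order.strict_trans1 abs_mult)
  then show "set_integrable lebesgue (S r) (\<lambda>v. norm v powr p)"
    using meas by (simp add: set_integrable_def integrable_completion mult.commute)
  have "ennreal (LINT v|lborel. norm v powr p * indicator (S r) v) \<le> ennreal (D * m powr (p + n) * r powr (p + n))"
    using * int by (subst nn_integral_eq_integral[symmetric]) auto
  then show "(LINT v:S r|lebesgue. norm v powr p) \<le> D * m powr (p + n) * r powr (p + real DIM('a))"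
    using D meas by (subst (asm) ennreal_le_iff)
      (auto simp: set_lebesgue_integral_def integral_completion n_def mult.commute)
qed

lemma norm_powr_integral_ball:
  fixes p :: real
  assumes "p + real DIM('a::euclidean_space) > 0"
  obtains C where "C \<ge> 0"
    "\<And>r. r > 0 \<Longrightarrow> set_integrable lebesgue (ball 0 r) (\<lambda>v::'a. norm v powr p)"
    "\<And>r. r > 0 \<Longrightarrow> (LINT v::'a:ball 0 r|lebesgue. norm v powr p) \<le> C * r powr (p + real DIM('a))"
proof (rule norm_powr_integral_dyadic[where S="\<lambda>r. ball (0::'a) r" and q="1/2" and p=p and m=1])
  show "(1/2) powr (p + real DIM('a)) < 1"
    using assms powr_less_cancel_iff[of 2 "- (p + real DIM('a))" 0] by (simp add: powr_divide powr_minus divide_simps)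
  fix r :: real and v :: 'a assume r: "r > 0" and v: "v \<in> ball 0 r" "v \<noteq> 0"
  define P where "P k \<longleftrightarrow> r * (1/2) ^ k / 2 \<le> norm v" for k
  obtain k0 where "(1/2::real) ^ k0 < norm v / r"
    using real_arch_pow_inv[of "norm v / r" "1/2"] r v by auto
  then have "P k0" using r v unfolding P_def by (auto simp: field_simps)
  \<comment> \<open>Failure of \<open>P\<close> at the predecessor of \<open>k\<close> is the upper
    bound for \<open>norm v\<close>; for \<open>k = 0\<close> the upper bound is membership in the
    ball.\<close>
  define k where "k = (LEAST k. P k)"
  have k: "P k" unfolding k_def using \<open>P k0\<close> by (rule LeastI)
  have "norm v \<le> r * (1/2) ^ k"
  proof (cases k)
    case (Suc j)
    then have "\<not> P j" using not_less_Least[of j P] by (simp add: k_def)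
    then show ?thesis using Suc by (simp add: P_def)
  qed (use v in simp)
  then show "\<exists>k. 1 * r * (1/2) ^ k / 2 \<le> norm v \<and> norm v \<le> 1 * r * (1/2) ^ k"
    using k by (auto simp: P_def)
qed (use that in auto)

lemma norm_powr_integral_outside_ball:
  fixes p :: real
  assumes "p + real DIM('a::euclidean_space) < 0"
  obtains C where "C \<ge> 0"
    "\<And>r. r > 0 \<Longrightarrow> set_integrable lebesgue (- ball 0 r) (\<lambda>v::'a. norm v powr p)"
    "\<And>r. r > 0 \<Longrightarrow> (LINT v::'a:- ball 0 r|lebesgue. norm v powr p) \<le> C * r powr (p + real DIM('a))"
proof (rule norm_powr_integral_dyadic[where S="\<lambda>r. - ball (0::'a) r" and q="2" and p=p and m=2])
  show "2 powr (p + real DIM('a)) < 1"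
    using assms powr_less_cancel_iff[of 2 "p + real DIM('a)" 0] by simp
  fix r :: real and v :: 'a assume r: "r > 0" and v: "v \<in> - ball 0 r" "v \<noteq> 0"
  define P where "P k \<longleftrightarrow> norm v \<le> 2 * r * 2 ^ k" for k
  obtain k0 where "norm v / r < 2 ^ k0"
    using real_arch_pow[of 2 "norm v / r"] by auto
  then have "P k0" using r v unfolding P_def by (auto simp: field_simps)
  \<comment> \<open>Here minimality yields the lower bound, and for \<open>k = 0\<close> it comes
    from \<open>v\<close> lying outside the ball.\<close>
  define k where "k = (LEAST k. P k)"
  have k: "P k" unfolding k_def using \<open>P k0\<close> by (rule LeastI)
  have "r * 2 ^ k \<le> norm v"
  proof (cases k)
    case (Suc j)
    then have "\<not> P j" using not_less_Least[of j P] by (simp add: k_def)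
    then show ?thesis using Suc by (simp add: P_def)
  qed (use v in simp)
  then show "\<exists>k. 2 * r * 2 ^ k / 2 \<le> norm v \<and> norm v \<le> 2 * r * 2 ^ k"
    using k by (auto simp: P_def)
qed (use that in auto)

section \<open>Admissible matrices\<close>

lemma inner_symmetric_matrix:
  fixes A :: "real ^ 'n ^ 'n"
  assumes "transpose A = A"
  shows "(A *v x) \<bullet> y = x \<bullet> (A *v y)"
  by (metis assms dot_lmul_matrix transpose_matrix_vector)

lemma mat_mult_vec: "mat c *v v = c *\<^sub>R (v :: real ^ 'n)"
  by (simp add: vec_eq_iff matrix_vector_mult_def mat_def mult_delta_left)

text \<open>The upper bound comes from \<open>0 \<le> u \<bullet> A u\<close> with \<open>u = v - A v / \<Theta>\<close>.\<close>

lemma admissible_norm_bounds: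
  fixes A :: "real ^ 'n ^ 'n"
  assumes A: "A \<in> admissible \<theta> \<Theta> e" and "0 < \<theta>" "\<theta> \<le> \<Theta>"
  shows "\<theta> * norm v \<le> norm (A *v v)" and "norm (A *v v) \<le> \<Theta> * norm v"
proof -
  have sym: "(A *v x) \<bullet> y = x \<bullet> (A *v y)" for x y
    using A by (intro inner_symmetric_matrix) (simp add: admissible_def)
  have lo: "\<theta> * (v \<bullet> v) \<le> v \<bullet> (A *v v)" and up: "v \<bullet> (A *v v) \<le> \<Theta> * (v \<bullet> v)" for v
    using A by (auto simp: admissible_def loewner_le_def mat_mult_vec)
  show "\<theta> * norm v \<le> norm (A *v v)"
  proof (cases "v = 0")
    case False
    have "\<theta> * norm v * norm v \<le> norm v * norm (A *v v)"
      using lo[of v] norm_cauchy_schwarz[of v "A *v v"] by (simp add: dot_square_norm power2_eq_square)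
    then show ?thesis using False by (simp add: mult.commute)
  qed simp
  define u where "u = v - (1 / \<Theta>) *\<^sub>R (A *v v)"
  have \<Theta>: "\<Theta> > 0" using assms by simp
  have "0 \<le> \<theta> * (u \<bullet> u)" using assms by simp
  also have "\<dots> \<le> u \<bullet> (A *v u)" by (rule lo)
  also have "\<dots> = v \<bullet> (A *v v) - 2 / \<Theta> * ((A *v v) \<bullet> (A *v v)) + (A *v v) \<bullet> (A *v (A *v v)) / \<Theta>\<^sup>2"
  proof -
    define g where "g = A *v v"
    have "A *v u = g - (1 / \<Theta>) *\<^sub>R (A *v g)"
      by (simp only: u_def g_def matrix_vector_mult_diff_distrib matrix_vector_mult_scaleR)
    moreover have "u = v - (1 / \<Theta>) *\<^sub>R g" by (simp only: u_def g_def)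
    moreover have "v \<bullet> (A *v g) = g \<bullet> g" by (simp only: sym[symmetric] g_def)
    ultimately have "u \<bullet> (A *v u) = v \<bullet> g - 2 / \<Theta> * (g \<bullet> g) + g \<bullet> (A *v g) / \<Theta>\<^sup>2"
      by (simp add: inner_diff_left inner_diff_right power2_eq_square diff_divide_distrib)
    then show ?thesis by (simp only: g_def)
  qed
  finally have 0: "0 \<le> v \<bullet> (A *v v) - 2 / \<Theta> * ((A *v v) \<bullet> (A *v v)) + (A *v v) \<bullet> (A *v (A *v v)) / \<Theta>\<^sup>2" .
  \<comment> \<open>Applied with \<open>G\<close> the squared norm of \<open>A *v v\<close>,
    \<open>W\<close> the form of \<open>A\<close> at \<open>v\<close>, and \<open>Z\<close> the form
    at \<open>A *v v\<close>; the bound on \<open>Z\<close> is \<open>up\<close> at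
    \<open>A *v v\<close>.\<close>
  have "G \<le> \<Theta> * W" if "0 \<le> W - 2 / \<Theta> * G + Z / \<Theta>\<^sup>2" "Z \<le> \<Theta> * G" for G W Z :: real
  proof -
    have "Z / \<Theta>\<^sup>2 \<le> \<Theta> * G / \<Theta>\<^sup>2" using that \<Theta> by (intro divide_right_mono) auto
    then have "0 \<le> W - G / \<Theta>" using that(1) \<Theta> by (simp add: power2_eq_square)
    then show ?thesis using \<Theta> by (simp add: field_simps)
  qed
  from this[OF 0 up] have "(A *v v) \<bullet> (A *v v) \<le> \<Theta> * (v \<bullet> (A *v v))" .
  also have "\<dots> \<le> \<Theta> * (\<Theta> * (v \<bullet> v))" using up \<Theta> by (intro mult_left_mono) auto
  finally have "(norm (A *v v))\<^sup>2 \<le> (\<Theta> * norm v)\<^sup>2"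
    by (simp add: dot_square_norm power_mult_distrib power2_eq_square mult_ac)
  then show "norm (A *v v) \<le> \<Theta> * norm v"
    using \<Theta> by (auto intro: power2_le_imp_le)
qed

lemma admissible_invertible:
  fixes A :: "real ^ 'n ^ 'n"
  assumes A: "A \<in> admissible \<theta> \<Theta> e" and "0 < \<theta>" "\<theta> \<le> \<Theta>"
  shows "invertible A"
proof -
  have "x = 0" if "A *v x = 0" for x
    using admissible_norm_bounds(1)[OF assms, of x] that assms by (simp add: mult_le_0_iff)
  then show ?thesis
    by (simp add: invertible_left_inverse matrix_left_invertible_ker)
qed

lemma matrix_inv_cancel:
  fixes A :: "real ^ 'n ^ 'n"
  assumes "invertible A"
  shows "A *v (matrix_inv A *v v) = v" and "matrix_inv A *v (A *v v) = v"
proof -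
  have "A ** matrix_inv A = mat 1 \<and> matrix_inv A ** A = mat 1"
    using assms unfolding matrix_inv_def invertible_def by (rule someI_ex)
  then show "A *v (matrix_inv A *v v) = v" and "matrix_inv A *v (A *v v) = v"
    by (simp_all add: matrix_vector_mul_assoc)
qed

lemma admissible_matrix_inv_cancel:
  fixes A :: "real ^ 'n ^ 'n"
  assumes A: "A \<in> admissible \<theta> \<Theta> e" and "0 < \<theta>" "\<theta> \<le> \<Theta>"
  shows "A *v (matrix_inv A *v v) = v"
  by (rule matrix_inv_cancel(1)[OF admissible_invertible[OF assms]])

lemma admissible_inv_norm_bounds:
  fixes A :: "real ^ 'n ^ 'n"
  assumes A: "A \<in> admissible \<theta> \<Theta> e" and "0 < \<theta>" "\<theta> \<le> \<Theta>"
  shows "norm (matrix_inv A *v v) \<le> norm v / \<theta>" and "norm v / \<Theta> \<le> norm (matrix_inv A *v v)"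
  using admissible_norm_bounds[OF assms, of "matrix_inv A *v v"] assms
  by (simp_all add: admissible_matrix_inv_cancel[OF assms] field_simps)

text \<open>This is where the eigenvector condition enters. The inverse \<open>B\<close> has
  \<open>e\<close> as an eigenvector, with eigenvalue \<open>\<beta>\<close>, so reflecting
  \<open>y\<close> changes only the \<open>e\<close>-component of \<open>B *v (y - x)\<close>. With
  \<open>p\<close> and \<open>d\<close> the heights of \<open>y\<close> and \<open>x\<close> above
  the hyperplane, that component passes from \<open>\<beta> * (p - d)\<close> to
  \<open>- \<beta> * (p + d)\<close>. The squares differ by
  \<open>4 * p * d * \<beta>\<^sup>2\<close>, and \<open>\<bar>\<beta>\<bar>\<close> is at least
  \<open>1 / \<Theta>\<close>.\<close>

lemma admissible_inv_reflect:
  fixes A :: "real ^ 'n ^ 'n"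
  assumes A: "A \<in> admissible \<theta> \<Theta> e" and "0 < \<theta>" "\<theta> \<le> \<Theta>" "norm e = 1" and pos: "x \<bullet> e > t" "y \<bullet> e > t"
  shows "(norm (matrix_inv A *v (y - x)))\<^sup>2 + 4 * (y \<bullet> e - t) * (x \<bullet> e - t) / \<Theta>\<^sup>2
    \<le> (norm (matrix_inv A *v (reflect e t y - x)))\<^sup>2"
proof -
  define B where "B = matrix_inv A"
  have sym: "(A *v x) \<bullet> y = x \<bullet> (A *v y)" for x y
    using A by (intro inner_symmetric_matrix) (simp add: admissible_def)
  have AB: "A *v (B *v v) = v" for v
    unfolding B_def by (rule admissible_matrix_inv_cancel[OF assms(1-3)])
  have BA: "B *v (A *v v) = v" for v
    unfolding B_def by (rule matrix_inv_cancel(2)[OF admissible_invertible[OF assms(1-3)]])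
  obtain \<mu> where \<mu>: "A *v e = \<mu> *\<^sub>R e" using A by (auto simp: admissible_def is_eigenvector_def)
  have "\<mu> \<noteq> 0" using admissible_norm_bounds(1)[OF assms(1-3), of e] \<mu> assms by auto
  define \<beta> where "\<beta> = 1 / \<mu>"
  have "e = \<mu> *\<^sub>R (B *v e)" using BA[of e] by (simp add: \<mu> matrix_vector_mult_scaleR)
  then have Be: "B *v e = \<beta> *\<^sub>R e"
    using \<open>\<mu> \<noteq> 0\<close> by (metis \<beta>_def divideR_right inverse_eq_divide)
  have ee: "e \<bullet> e = 1" using assms by (simp add: dot_square_norm)
  \<comment> \<open>Pairing \<open>B *v z\<close> with \<open>A *v e\<close> transfers the
    eigenvector relation to \<open>B\<close> through the symmetry of \<open>A\<close>.\<close>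
  have Bz: "(B *v z) \<bullet> e = \<beta> * (z \<bullet> e)" for z
  proof -
    have "z \<bullet> e = (B *v z) \<bullet> (A *v e)" by (subst sym[symmetric]) (simp add: AB)
    then show ?thesis using \<open>\<mu> \<noteq> 0\<close> by (simp add: \<mu> \<beta>_def)
  qed
  have "1 / \<Theta> \<le> \<bar>\<beta>\<bar>"
    using admissible_inv_norm_bounds(2)[OF assms(1-3), of e] assms by (simp add: B_def[symmetric] Be)
  then have "(1 / \<Theta>)\<^sup>2 \<le> \<beta>\<^sup>2"
    using assms by (metis abs_le_square_iff abs_of_pos divide_pos_pos less_le_trans zero_less_one)
  then have \<beta>: "4 * (y \<bullet> e - t) * (x \<bullet> e - t) / \<Theta>\<^sup>2 \<le> 4 * (y \<bullet> e - t) * (x \<bullet> e - t) * \<beta>\<^sup>2"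
    using pos mult_left_mono[of "(1 / \<Theta>)\<^sup>2" "\<beta>\<^sup>2" "4 * (y \<bullet> e - t) * (x \<bullet> e - t)"] by (simp add: power_divide)
  define p z where "p = y \<bullet> e - t" and "z = y - x"
  have "B *v (reflect e t y - x) = B *v z - (2 * p * \<beta>) *\<^sub>R e"
    by (simp add: reflect_def z_def p_def matrix_vector_mult_diff_distrib matrix_vector_mult_scaleR Be algebra_simps)
  moreover have nu: "(norm (u - c *\<^sub>R e))\<^sup>2 = (norm u)\<^sup>2 - 2 * c * (u \<bullet> e) + c * c" for u c
    by (simp only: power2_norm_eq_inner inner_diff_left inner_diff_right inner_scaleR_left
      inner_scaleR_right ee inner_commute[of e u]) (simp add: algebra_simps)
  ultimately have "(norm (B *v (reflect e t y - x)))\<^sup>2 =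
      (norm (B *v z))\<^sup>2 - 2 * (2 * p * \<beta>) * ((B *v z) \<bullet> e) + (2 * p * \<beta>) * (2 * p * \<beta>)"
    by simp
  also have "(B *v z) \<bullet> e = \<beta> * (p - (x \<bullet> e - t))"
    unfolding Bz by (simp add: z_def p_def inner_diff_left)
  also have "(norm (B *v z))\<^sup>2 - 2 * (2 * p * \<beta>) * (\<beta> * (p - (x \<bullet> e - t))) + (2 * p * \<beta>) * (2 * p * \<beta>) =
      (norm (B *v z))\<^sup>2 + 4 * p * (x \<bullet> e - t) * \<beta>\<^sup>2"
    by (simp add: power2_eq_square[of \<beta>] algebra_simps)
  finally show ?thesis using \<beta> by (simp add: B_def z_def p_def)
qed

text \<open>Supplies the nonemptiness required for lower bounds on the infimum in
  \<open>Fs\<close>.\<close>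

lemma mat_admissible:
  fixes e :: "real ^ 'n"
  assumes "\<theta> \<le> \<Theta>" "e \<noteq> 0"
  shows "mat \<theta> \<in> admissible \<theta> \<Theta> e"
proof -
  have "\<theta> * (v \<bullet> v) \<le> \<Theta> * (v \<bullet> v)" for v :: "real ^ 'n"
    using assms by (intro mult_right_mono) auto
  moreover have "mat \<theta> *v e = \<theta> *\<^sub>R e" by (rule mat_mult_vec)
  ultimately show ?thesis
    unfolding admissible_def loewner_le_def is_eigenvector_def
    using assms by (auto simp only: mat_mult_vec transpose_mat inner_scaleR_right order_refl)
qed

lemma admissible_uminus: "admissible \<theta> \<Theta> (- e) = admissible \<theta> \<Theta> (e :: real ^ 'n)"
proof -
  have "A *v (- e) = - (A *v e)" for A :: "real ^ 'n ^ 'n"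
    by (rule linear_neg[OF matrix_vector_mul_linear])
  then show ?thesis by (simp add: admissible_def is_eigenvector_def)
qed

section \<open>Set integrals, Taylor expansion and lower semicontinuity\<close>

lemma set_integral_measure_preserving:
  fixes f :: "'a::euclidean_space \<Rightarrow> real"
  assumes R: "R \<in> lebesgue \<rightarrow>\<^sub>M lebesgue" "distr lebesgue lebesgue R = (lebesgue :: 'a measure)"
    and f: "set_integrable lebesgue A f"
  shows "set_integrable lebesgue (R -` A) (\<lambda>x. f (R x))"
    and "(LINT x:R -` A|lebesgue. f (R x)) = (LINT x:A|lebesgue. f x)"
proof -
  let ?g = "\<lambda>x. indicator A x *\<^sub>R f x"
  have g: "integrable lebesgue ?g" using f by (simp only: set_integrable_def)
  have eq: "indicator (R -` A) x *\<^sub>R f (R x) = ?g (R x)" for x by (simp add: indicator_def)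
  have "integrable lebesgue (\<lambda>x. ?g (R x))"
    by (rule integrable_distr[OF R(1)]) (simp only: R(2) g)
  then show "set_integrable lebesgue (R -` A) (\<lambda>x. f (R x))"
    unfolding set_integrable_def eq .
  have "integral\<^sup>L (distr lebesgue lebesgue R) ?g = integral\<^sup>L lebesgue (\<lambda>x. ?g (R x))"
    by (rule integral_distr[OF R(1)]) (use g in \<open>rule borel_measurable_integrable\<close>)
  then show "(LINT x:R -` A|lebesgue. f (R x)) = (LINT x:A|lebesgue. f x)"
    unfolding set_lebesgue_integral_def eq R(2) by simp
qed

lemma lebesgue_measurable_borel: "f \<in> borel_measurable borel \<Longrightarrow> f \<in> borel_measurable lebesgue"
  by (rule measurable_completion) simp

lemma lebesgue_preserving_affine:
  fixes f :: "'a::euclidean_space \<Rightarrow> 'a"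
  assumes f: "orthogonal_transformation f"
  shows "(\<lambda>x. a + f x) \<in> lebesgue \<rightarrow>\<^sub>M lebesgue"
    and "distr lebesgue lebesgue (\<lambda>x. a + f x) = lebesgue"
proof -
  have [measurable]: "f \<in> borel_measurable borel"
    by (intro borel_measurable_continuous_onI linear_continuous_on linear_conv_bounded_linear[THEN iffD1]
      orthogonal_transformation_linear f)
  have "distr lborel borel (\<lambda>x. a + f x) = distr (distr lborel borel f) borel ((+) a)"
    by (subst distr_distr) (auto simp: comp_def)
  then have 1: "distr lborel borel (\<lambda>x. a + f x) = lborel"
    by (simp add: lborel_distr_orthogonal[OF f] lborel_distr_plus)
  have 2: "(\<lambda>x. a + f x) \<in> borel_measurable borel" by measurable
  show "(\<lambda>x. a + f x) \<in> lebesgue \<rightarrow>\<^sub>M lebesgue" "distr lebesgue lebesgue (\<lambda>x. a + f x) = lebesgue"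
    by (rule lebesgue_measure_preserving[OF 2 1])+
qed

lemma set_integral_lebesgue_translate:
  fixes f :: "'a::euclidean_space \<Rightarrow> real"
  assumes "set_integrable lebesgue A f"
  shows "set_integrable lebesgue {y. y - x \<in> A} (\<lambda>y. f (y - x))"
    and "(LINT y:{y. y - x \<in> A}|lebesgue. f (y - x)) = (LINT y:A|lebesgue. f y)"
  using set_integral_measure_preserving[OF lebesgue_preserving_affine[of id "- x"] assms]
  by (simp_all add: orthogonal_transformation_def linear_id vimage_def)

lemma set_integral_lebesgue_point_reflection:
  fixes f :: "'a::euclidean_space \<Rightarrow> real"
  assumes "set_integrable lebesgue A f"
  shows "(LINT y:{y. 2 *\<^sub>R x - y \<in> A}|lebesgue. f (2 *\<^sub>R x - y)) = (LINT y:A|lebesgue. f y)"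
  using set_integral_measure_preserving(2)[OF lebesgue_preserving_affine[of uminus "2 *\<^sub>R x"] assms]
  by (simp add: orthogonal_transformation_neg[of id, simplified] orthogonal_transformation_def linear_uminus vimage_def)

lemma set_integral_subset_mono:
  fixes f :: "'a \<Rightarrow> real"
  assumes "set_integrable M B f" "A \<in> sets M" "A \<subseteq> B" "\<And>x. x \<in> B \<Longrightarrow> 0 \<le> f x"
  shows "(LINT x:A|M. f x) \<le> (LINT x:B|M. f x)"
  unfolding set_lebesgue_integral_def
  using assms set_integrable_subset[OF assms(1-3)]
  by (intro integral_mono) (auto simp: set_integrable_def indicator_def)

text \<open>Dominated convergence: the indicators tend to 0 at every point except the centre, which
  is a null set.\<close>

lemma set_integral_shrinking_ball:
  fixes g :: "'a::euclidean_space \<Rightarrow> real"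
  assumes g: "set_integrable lebesgue (ball x r) g" and "r > 0"
  shows "((\<lambda>\<epsilon>. LINT y:ball x \<epsilon>|lebesgue. g y) \<longlongrightarrow> 0) (at_right 0)"
proof (rule tendsto_at_right_sequentially[OF \<open>r > 0\<close>])
  fix S assume S: "\<And>n. 0 < S n" "\<And>n. S n < r" "S \<longlonglongrightarrow> (0::real)"
  have gi: "integrable lebesgue (\<lambda>y. indicator (ball x r) y *\<^sub>R g y)"
    using g by (simp only: set_integrable_def)
  have "(\<lambda>n. integral\<^sup>L lebesgue (\<lambda>y. indicator (ball x (S n)) y *\<^sub>R g y)) \<longlonglongrightarrow> integral\<^sup>L lebesgue (\<lambda>y::'a. 0)"
  proof (rule integral_dominated_convergence)
    show "integrable lebesgue (\<lambda>y. norm (indicator (ball x r) y *\<^sub>R g y))"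
      using gi by (rule integrable_norm)
    fix n
    have "set_integrable lebesgue (ball x (S n)) g"
      by (rule set_integrable_subset[OF g]) (use S(2)[of n] in auto)
    then show "(\<lambda>y. indicator (ball x (S n)) y *\<^sub>R g y) \<in> borel_measurable lebesgue"
      unfolding set_integrable_def by (rule borel_measurable_integrable)
    show "AE y in lebesgue. norm (indicator (ball x (S n)) y *\<^sub>R g y) \<le> norm (indicator (ball x r) y *\<^sub>R g y)"
      using S(2)[of n] by (auto simp: indicator_def)
  next
    show "AE y in lebesgue. (\<lambda>n. indicator (ball x (S n)) y *\<^sub>R g y) \<longlonglongrightarrow> 0"
      using AE_completion[OF AE_lborel_singleton[of x]]
    proof (rule AE_mp, intro AE_I2 impI)
      fix y :: 'a assume "y \<noteq> x"
      then have "eventually (\<lambda>n. S n < dist x y) sequentially"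
        using S(3) by (intro order_tendstoD) auto
      then show "(\<lambda>n. indicator (ball x (S n)) y *\<^sub>R g y) \<longlonglongrightarrow> 0"
        by (rule tendsto_eventually[OF eventually_mono]) (auto simp: indicator_def)
    qed
  qed auto
  then show "(\<lambda>n. LINT y:ball x (S n)|lebesgue. g y) \<longlonglongrightarrow> 0"
    by (simp add: set_lebesgue_integral_def)
qed

text \<open>The mean value inequality is applied to \<open>u\<close> minus its linear part at
  \<open>x\<close>, on the closed ball of radius \<open>norm (y - x)\<close>; there the Lipschitz
  gradient differs from \<open>Du x\<close> by at most \<open>L * norm (y - x)\<close>.\<close>

lemma C11_loc_taylor:
  fixes u :: "real ^ 'n \<Rightarrow> real"
  assumes u: "u \<in> C11_loc \<Omega>" and "open \<Omega>" "x \<in> \<Omega>"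
  obtains r b M where "r > 0" "M \<ge> 0"
    "\<And>y. y \<in> ball x r \<Longrightarrow> \<bar>u y - u x - b \<bullet> (y - x)\<bar> \<le> M * (norm (y - x))\<^sup>2"
proof -
  obtain Du where Du: "\<And>x. x \<in> \<Omega> \<Longrightarrow> GDERIV u x :> Du x"
    and lip: "\<exists>r>0. \<exists>L. L-lipschitz_on (ball x r \<inter> \<Omega>) Du"
    using u assms(3) unfolding C11_loc_def by blast
  obtain r1 L where r1: "r1 > 0" "L-lipschitz_on (ball x r1 \<inter> \<Omega>) Du" using lip by blast
  obtain r2 where r2: "r2 > 0" "ball x r2 \<subseteq> \<Omega>" using assms by (meson open_contains_ball)
  define r where "r = min r1 r2"
  have "L \<ge> 0" using r1(2) by (rule lipschitz_on_nonneg)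
  have "\<bar>u y - u x - Du x \<bullet> (y - x)\<bar> \<le> L * (norm (y - x))\<^sup>2" if y: "y \<in> ball x r" for y
  proof -
    define \<delta> where "\<delta> = norm (y - x)"
    have sub: "cball x \<delta> \<subseteq> ball x r1 \<inter> \<Omega>"
      using y r2 by (auto simp: \<delta>_def r_def dist_norm norm_minus_commute subset_iff)
    have "norm ((u y - Du x \<bullet> y) - (u x - Du x \<bullet> x)) \<le> (L * \<delta>) * norm (y - x)"
    proof (rule differentiable_bound[where f = "\<lambda>z. u z - Du x \<bullet> z" and S = "cball x \<delta>"
        and f' = "\<lambda>z h. h \<bullet> Du z - Du x \<bullet> h"])
      fix z assume z: "z \<in> cball x \<delta>"
      then have "(u has_derivative (\<lambda>h. h \<bullet> Du z)) (at z)"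
        using Du[of z] sub unfolding gderiv_def by blast
      then have "((\<lambda>z. u z - Du x \<bullet> z) has_derivative (\<lambda>h. h \<bullet> Du z - Du x \<bullet> h)) (at z)"
        by (intro has_derivative_diff bounded_linear_imp_has_derivative bounded_linear_inner_right)
      then show "((\<lambda>z. u z - Du x \<bullet> z) has_derivative (\<lambda>h. h \<bullet> Du z - Du x \<bullet> h)) (at z within cball x \<delta>)"
        by (rule has_derivative_at_withinI)
      have "dist (Du z) (Du x) \<le> L * dist z x"
        by (rule lipschitz_onD[OF r1(2)]) (use sub z r1(1) assms(3) in auto)
      also have "\<dots> \<le> L * \<delta>" using z \<open>L \<ge> 0\<close> by (intro mult_left_mono) (auto simp: dist_commute)
      finally have D: "norm (Du z - Du x) \<le> L * \<delta>" by (simp add: dist_norm)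
      show "onorm (\<lambda>h. h \<bullet> Du z - Du x \<bullet> h) \<le> L * \<delta>"
      proof (rule onorm_bound)
        show "0 \<le> L * \<delta>" using \<open>L \<ge> 0\<close> by (simp add: \<delta>_def)
        fix h
        have "h \<bullet> Du z - Du x \<bullet> h = h \<bullet> (Du z - Du x)"
          by (simp add: inner_diff_right inner_commute)
        then have "norm (h \<bullet> Du z - Du x \<bullet> h) \<le> norm h * norm (Du z - Du x)"
          by (simp add: Cauchy_Schwarz_ineq2)
        also have "\<dots> \<le> norm h * (L * \<delta>)" using D by (intro mult_left_mono) auto
        finally show "norm (h \<bullet> Du z - Du x \<bullet> h) \<le> L * \<delta> * norm h" by (simp add: mult_ac)
      qed
    qed (auto simp: \<delta>_def dist_norm norm_minus_commute)
    then show ?thesis by (simp add: \<delta>_def inner_diff_right power2_eq_square algebra_simps)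
  qed
  then show ?thesis using that[of r L "Du x"] r1 r2 \<open>L \<ge> 0\<close> by (simp add: r_def)
qed

text \<open>If no minimum exists, each \<open>z\<close> has a point \<open>Y z\<close> of smaller
  value, and \<open>f\<close> exceeds \<open>f (Y z)\<close> on a neighbourhood \<open>U z\<close>.
  A finite subcover leaves finitely many values \<open>f (Y i)\<close>, and the point realising the
  least of them gives the contradiction.\<close>

lemma lsc_on_attains_inf:
  fixes f :: "'a::topological_space \<Rightarrow> real"
  assumes "compact S" "S \<noteq> {}" and lsc: "lsc_on S f"
  obtains z where "z \<in> S" "\<And>y. y \<in> S \<Longrightarrow> f z \<le> f y"
proof (rule ccontr)
  assume "\<not> thesis"
  then have "\<forall>z\<in>S. \<exists>y\<in>S. f y < f z" using that by (meson not_le)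
  then obtain Y where Y: "\<And>z. z \<in> S \<Longrightarrow> Y z \<in> S \<and> f (Y z) < f z" by metis
  have "\<exists>U. open U \<and> z \<in> U \<and> (\<forall>y\<in>U \<inter> S. f (Y z) < f y)" if z: "z \<in> S" for z
  proof -
    have "eventually (\<lambda>y. f (Y z) < f y) (at z within S)"
      using lsc Y[OF z] z by (auto simp: lsc_on_def)
    then obtain U where U: "open U" "z \<in> U" "\<forall>y\<in>U. y \<noteq> z \<longrightarrow> y \<in> S \<longrightarrow> f (Y z) < f y"
      by (auto simp: eventually_at_topological)
    then show ?thesis using Y[OF z] by (intro exI[of _ U]) auto
  qed
  then obtain U where U: "\<And>z. z \<in> S \<Longrightarrow> open (U z)" "\<And>z. z \<in> S \<Longrightarrow> z \<in> U z"
    "\<And>z y. z \<in> S \<Longrightarrow> y \<in> U z \<Longrightarrow> y \<in> S \<Longrightarrow> f (Y z) < f y"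
    by (metis IntI)
  have cov: "S \<subseteq> (\<Union>z\<in>S. U z)" using U(2) by blast
  obtain F where F: "F \<subseteq> S" "finite F" "S \<subseteq> (\<Union>z\<in>F. U z)"
    by (rule compactE_image[OF \<open>compact S\<close> U(1) cov])
  have "F \<noteq> {}" using F \<open>S \<noteq> {}\<close> by auto
  obtain j where j: "j \<in> F" "\<And>i. i \<in> F \<Longrightarrow> f (Y j) \<le> f (Y i)"
    using arg_min_if_finite[OF F(2) \<open>F \<noteq> {}\<close>, of "\<lambda>i. f (Y i)"] by (metis not_le)
  \<comment> \<open>\<open>Y j\<close> itself lies in some \<open>U i\<close>, where
    \<open>f\<close> exceeds \<open>f (Y i)\<close>, against the choice of \<open>j\<close>.\<close>
  have "Y j \<in> S" using Y j F by auto
  then obtain i where i: "i \<in> F" "Y j \<in> U i" using F by auto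
  then have "f (Y i) < f (Y j)" using U(3)[of i "Y j"] F \<open>Y j \<in> S\<close> by auto
  then show False using j(2)[OF i(1)] by simp
qed

section \<open>Principal values of antisymmetric functions\<close>

lemma reflect_inner: "norm e = 1 \<Longrightarrow> reflect e t x \<bullet> e = 2 * t - x \<bullet> e"
  by (simp add: reflect_def inner_diff_left dot_square_norm)

lemma reflect_reflect: "norm e = 1 \<Longrightarrow> reflect e t (reflect e t x) = x"
  by (simp add: reflect_def[of e t "reflect e t x"] reflect_inner) (simp add: reflect_def algebra_simps)

lemma reflect_dist:
  assumes "norm e = 1"
  shows "norm (reflect e t x - reflect e t y) = norm (x - y)"
proof -
  have "reflect e t x - reflect e t y = (x - y) - (2 * ((x - y) \<bullet> e)) *\<^sub>R e"
    by (simp add: reflect_def algebra_simps)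
  moreover have "(norm (z - (2 * (z \<bullet> e)) *\<^sub>R e))\<^sup>2 = (norm z)\<^sup>2" for z
    using assms unfolding power2_norm_eq_inner inner_diff_left inner_diff_right
    by (simp add: inner_commute[of e z] dot_square_norm power2_eq_square[of "z \<bullet> e"])
  ultimately show ?thesis by (metis norm_ge_zero power2_eq_imp_eq)
qed

lemma reflect_preserves_lebesgue:
  fixes e :: "real ^ 'n"
  assumes "norm e = 1"
  shows "reflect e t \<in> lebesgue \<rightarrow>\<^sub>M lebesgue" and "distr lebesgue lebesgue (reflect e t) = lebesgue"
proof -
  have eq: "(\<lambda>x. (2 * t) *\<^sub>R e + reflect e 0 x) = reflect e t"
    by (simp add: reflect_def fun_eq_iff algebra_simps)
  have "orthogonal_transformation (reflect e 0)"
    unfolding orthogonal_transformation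
  proof
    show "linear (reflect e 0)"
      by (rule linearI) (simp_all add: reflect_def algebra_simps)
    have "reflect e 0 0 = 0" by (simp add: reflect_def)
    then show "\<forall>v. norm (reflect e 0 v) = norm v"
      using reflect_dist[OF assms, of 0 _ 0] by simp
  qed
  from lebesgue_preserving_affine[OF this, of "(2 * t) *\<^sub>R e"]
  show "reflect e t \<in> lebesgue \<rightarrow>\<^sub>M lebesgue" "distr lebesgue lebesgue (reflect e t) = lebesgue"
    by (simp_all only: eq)
qed

lemma hyperplane_AE:
  fixes e :: "real ^ 'n"
  assumes "norm e = 1"
  shows "AE x in lebesgue. x \<bullet> e \<noteq> t"
proof -
  have "negligible {x. e \<bullet> x = t}" by (rule negligible_hyperplane) (use assms in auto)
  then have "AE x in lebesgue. x \<notin> {x. e \<bullet> x = t}"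
    unfolding negligible_iff_null_sets by (rule AE_not_in)
  then show ?thesis by (simp add: inner_commute)
qed

lemma set_borel_measurableI:
  fixes f :: "'a \<Rightarrow> real"
  assumes [measurable]: "f \<in> borel_measurable M" "A \<in> sets M"
  shows "set_borel_measurable M A f"
  unfolding set_borel_measurable_def by measurable

text \<open>The hypothesis \<open>x \<noteq> y\<close> in the comparison of \<open>K\<close> is needed because the kernels of interest have the
  junk value \<open>K 0 = 1 / 0 = 0\<close>.\<close>

locale reflected_kernel =
  fixes s t H N :: real and e :: "real ^ 'n" and K :: "real ^ 'n \<Rightarrow> real"
  assumes s: "0 < s" "s < 1" and e: "norm e = 1" and H: "0 \<le> H"
    and N: "N = real CARD('n) + 2 * s"
    and K_measurable: "K \<in> borel_measurable borel"
    and K_nonneg: "0 \<le> K v"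
    and K_even: "K (- v) = K v"
    and K_upper: "K v \<le> H * norm v powr - N"
    and K_reflect: "t < x \<bullet> e \<Longrightarrow> t < y \<bullet> e \<Longrightarrow> x \<noteq> y \<Longrightarrow> K (reflect e t y - x) \<le> K (y - x)"
begin

abbreviation "\<Sigma> \<equiv> {x. t < x \<bullet> e}"
abbreviation "R \<equiv> reflect e t"

lemma N_pos: "N > 0"
  using s by (simp add: N add_nonneg_pos)

lemma sets_\<Sigma> [measurable]: "\<Sigma> \<in> sets lebesgue" "{x. x \<bullet> e < t} \<in> sets lebesgue"
proof -
  have "\<Sigma> = {x. e \<bullet> x > t}" "{x. x \<bullet> e < t} = {x. e \<bullet> x < t}"
    by (auto simp: inner_commute)
  then show "\<Sigma> \<in> sets lebesgue" "{x. x \<bullet> e < t} \<in> sets lebesgue"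
    using open_halfspace_gt[of t e] open_halfspace_lt[of e t]
    by (metis borel_open sets_completionI_sets sets_lborel)+
qed

lemma K_meas [measurable]: "(\<lambda>y. K (y - x)) \<in> borel_measurable lebesgue"
proof -
  note K_measurable[measurable]
  show ?thesis by (rule lebesgue_measurable_borel) measurable
qed

lemma reflect_side: "x \<in> R -` {x. x \<bullet> e < t} \<longleftrightarrow> x \<in> \<Sigma>"
  using e by (auto simp: reflect_inner)

lemma ball_subset_\<Sigma>: "\<rho> \<le> x \<bullet> e - t \<Longrightarrow> ball x \<rho> \<subseteq> \<Sigma>"
proof
  fix y assume "\<rho> \<le> x \<bullet> e - t" "y \<in> ball x \<rho>"
  then have "norm (x - y) < x \<bullet> e - t" by (simp add: dist_norm)
  moreover have "(x - y) \<bullet> e \<le> norm (x - y)"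
    using norm_cauchy_schwarz[of "x - y" e] e by simp
  ultimately show "y \<in> \<Sigma>" by (simp add: inner_diff_left)
qed

text \<open>Integrability at infinity holds because the exponent \<open>- N\<close> plus the
  dimension is \<open>- 2 * s\<close>, which is negative.\<close>

lemma K_outside_ball:
  assumes "r > 0"
  shows "set_integrable lebesgue (- ball x r) (\<lambda>y. K (y - x))"
    and "(LINT y:- ball x r|lebesgue. K (y - x)) \<le> H * (LINT v:- ball 0 r|lebesgue. norm (v :: real ^ 'n) powr - N)"
proof -
  have "- N + real DIM(real ^ 'n) < 0" using s by (simp add: N)
  from norm_powr_integral_outside_ball[OF this] assms
  have int: "set_integrable lebesgue (- ball 0 r) (\<lambda>v :: real ^ 'n. norm v powr - N)" by blast
  have eq: "{y. y - x \<in> - ball 0 r} = - ball x r" by (auto simp: dist_norm norm_minus_commute)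
  note tr = set_integral_lebesgue_translate[OF int, of x, unfolded eq]
  have i1: "set_integrable lebesgue (- ball x r) (\<lambda>y. H * norm (y - x) powr - N)"
    using tr(1) by simp
  show i2: "set_integrable lebesgue (- ball x r) (\<lambda>y. K (y - x))"
    by (rule set_integrable_bound[OF i1 set_borel_measurableI])
      (use K_upper K_nonneg H K_meas in auto)
  have "(LINT y:- ball x r|lebesgue. K (y - x)) \<le> (LINT y:- ball x r|lebesgue. H * norm (y - x) powr - N)"
    by (rule set_integral_mono[OF i2 i1]) (rule K_upper)
  then show "(LINT y:- ball x r|lebesgue. K (y - x)) \<le> H * (LINT v:- ball 0 r|lebesgue. norm (v :: real ^ 'n) powr - N)"
    using tr(2) by simp
qed

text \<open>The squared distance tames the singularity, since \<open>2 - N\<close> plus the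
  dimension is \<open>2 - 2 * s > 0\<close>. This pays for quadratic Taylor remainders.\<close>

lemma K_inside_ball:
  assumes "r > 0"
  shows "set_integrable lebesgue (ball x r) (\<lambda>y. (norm (y - x))\<^sup>2 * K (y - x))"
    and "(LINT y:ball x r|lebesgue. (norm (y - x))\<^sup>2 * K (y - x))
      \<le> H * (LINT v:ball 0 r|lebesgue. norm (v :: real ^ 'n) powr (2 - N))"
proof -
  have "2 - N + real DIM(real ^ 'n) > 0" using s by (simp add: N)
  from norm_powr_integral_ball[OF this] assms
  have int: "set_integrable lebesgue (ball 0 r) (\<lambda>v :: real ^ 'n. norm v powr (2 - N))" by blast
  have eq: "{y. y - x \<in> ball 0 r} = ball x r" by (auto simp: dist_norm norm_minus_commute)
  note tr = set_integral_lebesgue_translate[OF int, of x, unfolded eq]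
  have i1: "set_integrable lebesgue (ball x r) (\<lambda>y. H * norm (y - x) powr (2 - N))"
    using tr(1) by simp
  have up: "(norm v)\<^sup>2 * K v \<le> H * norm v powr (2 - N)" for v
  proof (cases "v = 0")
    case False
    have "(norm v)\<^sup>2 * K v \<le> (norm v)\<^sup>2 * (H * norm v powr - N)"
      by (rule mult_left_mono[OF K_upper]) simp
    also have "\<dots> = H * norm v powr (2 - N)"
      using powr_add[of "norm v" 2 "- N"] False by simp
    finally show ?thesis .
  qed simp
  show i2: "set_integrable lebesgue (ball x r) (\<lambda>y. (norm (y - x))\<^sup>2 * K (y - x))"
  proof (rule set_integrable_bound[OF i1])
    have "(\<lambda>y. (norm (y - x))\<^sup>2) \<in> borel_measurable lebesgue"
      by (rule lebesgue_measurable_borel) measurable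
    then show "set_borel_measurable lebesgue (ball x r) (\<lambda>y. (norm (y - x))\<^sup>2 * K (y - x))"
      by (intro set_borel_measurableI borel_measurable_times K_meas) auto
  qed (use up K_nonneg H in \<open>auto simp: abs_mult\<close>)
  have "(LINT y:ball x r|lebesgue. (norm (y - x))\<^sup>2 * K (y - x)) \<le> (LINT y:ball x r|lebesgue. H * norm (y - x) powr (2 - N))"
    by (rule set_integral_mono[OF i2 i1]) (rule up)
  then show "(LINT y:ball x r|lebesgue. (norm (y - x))\<^sup>2 * K (y - x))
      \<le> H * (LINT v:ball 0 r|lebesgue. norm (v :: real ^ 'n) powr (2 - N))"
    using tr(2) by simp
qed

text \<open>Away from \<open>x\<close> the kernel decays at least as fast as the weight defining
  \<open>Ls\<close>, up to a constant depending on \<open>x\<close> and \<open>r\<close>.\<close>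

lemma Ls_K_outside_ball:
  assumes u: "u \<in> Ls s" and r: "r > 0"
  shows "set_integrable lebesgue (- ball x r) (\<lambda>y. u y * K (y - x))"
proof -
  \<comment> \<open>With \<open>\<delta> = norm (y - x) \<ge> r\<close>, the first summand comes
    from \<open>norm y \<le> (norm x / r + 1) * \<delta>\<close> and the second from
    \<open>1 \<le> r powr - N * \<delta> powr N\<close>.\<close>
  define C where "C = (norm x / r + 1) powr N + r powr - N"
  have um [measurable]: "u \<in> borel_measurable lebesgue"
    and ui: "integrable lebesgue (\<lambda>y. \<bar>u y\<bar> / (1 + norm y powr N))"
    using u by (simp_all add: Ls_def N)
  have i1: "set_integrable lebesgue (- ball x r) (\<lambda>y. H * C * (\<bar>u y\<bar> / (1 + norm y powr N)))"
    unfolding set_integrable_def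
    by (intro integrable_mult_indicator integrable_mult_right ui) auto
  have bd: "K (y - x) \<le> H * C / (1 + norm y powr N)" if y: "y \<in> - ball x r" for y
  proof -
    define \<delta> where "\<delta> = norm (y - x)"
    have \<delta>: "r \<le> \<delta>" using y by (simp add: \<delta>_def dist_norm norm_minus_commute)
    have "norm y \<le> norm x + \<delta>" unfolding \<delta>_def using norm_triangle_ineq[of x "y - x"] by simp
    also have "\<dots> \<le> (norm x / r + 1) * \<delta>"
    proof -
      have "norm x * 1 \<le> norm x * (\<delta> / r)" using \<delta> r by (intro mult_left_mono) auto
      then show ?thesis by (simp add: algebra_simps)
    qed
    finally have "norm y powr N \<le> ((norm x / r + 1) * \<delta>) powr N"
      using N_pos by (intro powr_mono2) auto
    also have "\<dots> = (norm x / r + 1) powr N * \<delta> powr N" using r \<delta> by (subst powr_mult) auto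
    finally have 1: "norm y powr N \<le> (norm x / r + 1) powr N * \<delta> powr N" .
    have "r powr N \<le> \<delta> powr N" using r \<delta> N_pos by (intro powr_mono2) auto
    then have "1 \<le> r powr - N * \<delta> powr N" using r by (simp add: powr_minus field_simps)
    then have "1 + norm y powr N \<le> C * \<delta> powr N" using 1 by (simp add: C_def algebra_simps)
    moreover have pos: "\<delta> powr N > 0" "1 + norm y powr N > 0" using r \<delta> by (auto intro: add_pos_nonneg)
    ultimately have "\<delta> powr - N \<le> C / (1 + norm y powr N)"
      by (simp add: powr_minus field_simps)
    then have "H * \<delta> powr - N \<le> H * (C / (1 + norm y powr N))" using H by (rule mult_left_mono)
    then show ?thesis using K_upper[of "y - x"] by (simp add: \<delta>_def)
  qed
  show ?thesis
  proof (rule set_integrable_bound[OF i1])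
    show "set_borel_measurable lebesgue (- ball x r) (\<lambda>y. u y * K (y - x))"
      by (intro set_borel_measurableI borel_measurable_times K_meas um) auto
    have "norm (u y * K (y - x)) \<le> norm (H * C * (\<bar>u y\<bar> / (1 + norm y powr N)))" if "y \<in> - ball x r" for y
    proof -
      have "\<bar>u y\<bar> * K (y - x) \<le> \<bar>u y\<bar> * (H * C / (1 + norm y powr N))"
        by (rule mult_left_mono[OF bd[OF that]]) simp
      also have "\<dots> = H * C * (\<bar>u y\<bar> / (1 + norm y powr N))" by (simp add: mult_ac)
      also have "\<dots> \<le> norm \<dots>" by (simp only: real_norm_def abs_ge_self)
      finally show ?thesis using K_nonneg by (simp add: abs_mult)
    qed
    then show "AE y in lebesgue. y \<in> - ball x r \<longrightarrow>
        norm (u y * K (y - x)) \<le> norm (H * C * (\<bar>u y\<bar> / (1 + norm y powr N)))" by blast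
  qed
qed

lemma increment_K_outside_ball:
  assumes u: "u \<in> Ls s" and r: "r > 0"
  shows "set_integrable lebesgue (- ball x r) (\<lambda>y. (u y - a) * K (y - x))"
  using set_integral_diff(1)[OF Ls_K_outside_ball[OF assms, of x] set_integrable_mult_right[OF K_outside_ball(1)[OF r, of x], of a]]
  by (simp add: algebra_simps)

text \<open>The point reflection of \<open>y\<close> to \<open>2 *\<^sub>R x - y\<close> preserves
  the annulus and the even kernel but changes the sign of the linear factor.\<close>

lemma odd_integral:
  assumes "\<epsilon> > 0"
  shows "set_integrable lebesgue (ball x r - ball x \<epsilon>) (\<lambda>y. (b \<bullet> (y - x)) * K (y - x))"
    and "(LINT y:ball x r - ball x \<epsilon>|lebesgue. (b \<bullet> (y - x)) * K (y - x)) = 0"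
proof -
  let ?A = "ball x r - ball x \<epsilon>" and ?f = "\<lambda>y. (b \<bullet> (y - x)) * K (y - x)"
  have i0: "set_integrable lebesgue ?A (\<lambda>y. norm b * r * K (y - x))"
    by (rule set_integrable_mult_right, rule set_integrable_subset[OF K_outside_ball(1)[OF assms]]) auto
  show i1: "set_integrable lebesgue ?A ?f"
  proof (rule set_integrable_bound[OF i0])
    have "(\<lambda>y. b \<bullet> (y - x)) \<in> borel_measurable lebesgue"
      by (rule lebesgue_measurable_borel) measurable
    then show "set_borel_measurable lebesgue ?A ?f"
      by (intro set_borel_measurableI borel_measurable_times K_meas) auto
    have "norm (?f y) \<le> norm (norm b * r * K (y - x))" if "y \<in> ?A" for y
    proof -
      have r: "norm (y - x) \<le> r" using that by (simp add: dist_norm norm_minus_commute)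
      have "\<bar>b \<bullet> (y - x)\<bar> \<le> norm b * norm (y - x)" by (rule Cauchy_Schwarz_ineq2)
      also have "\<dots> \<le> norm b * r" using r by (intro mult_left_mono) auto
      finally have "\<bar>b \<bullet> (y - x)\<bar> * K (y - x) \<le> norm b * r * K (y - x)"
        using K_nonneg by (intro mult_right_mono) auto
      moreover have "0 \<le> r" using r norm_ge_zero[of "y - x"] by linarith
      ultimately show ?thesis using K_nonneg by (simp add: abs_mult)
    qed
    then show "AE y in lebesgue. y \<in> ?A \<longrightarrow> norm (?f y) \<le> norm (norm b * r * K (y - x))" by blast
  qed
  have A: "{y. 2 *\<^sub>R x - y \<in> ?A} = ?A"
    by (auto simp: dist_norm scaleR_2 algebra_simps norm_minus_commute)
  have "2 *\<^sub>R x - y - x = - (y - x)" for y by (simp add: scaleR_2)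
  then have f: "?f (2 *\<^sub>R x - y) = - ?f y" for y by (simp only: K_even) (simp add: inner_diff_right algebra_simps)
  from set_integral_lebesgue_point_reflection[OF i1, of x, unfolded A f]
  show "(LINT y:?A|lebesgue. ?f y) = 0"
    using set_integral_uminus[OF i1] by simp
qed

text \<open>The kernel is even, so the linear Taylor term integrates to zero over annuli.\<close>

lemma pv_convergent:
  assumes u: "u \<in> Ls s" and r: "r > 0" and M: "M \<ge> 0"
    and taylor: "\<And>y. y \<in> ball x r \<Longrightarrow> \<bar>u y - u x - b \<bullet> (y - x)\<bar> \<le> M * (norm (y - x))\<^sup>2"
  obtains l where "((\<lambda>\<epsilon>. LINT y:- ball x \<epsilon>|lebesgue. (u y - u x) * K (y - x)) \<longlongrightarrow> l) (at_right 0)"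
proof -
  let ?f = "\<lambda>y. (u y - u x) * K (y - x)"
  let ?g = "\<lambda>y. (u y - u x - b \<bullet> (y - x)) * K (y - x)"
  have um: "u \<in> borel_measurable lebesgue" using u by (simp add: Ls_def)
  have bm: "(\<lambda>y. b \<bullet> (y - x)) \<in> borel_measurable lebesgue"
    by (rule lebesgue_measurable_borel) measurable
  have g: "set_integrable lebesgue (ball x r) ?g"
  proof (rule set_integrable_bound[OF set_integrable_mult_right[OF K_inside_ball(1)[OF r, of x], of M]])
    show "set_borel_measurable lebesgue (ball x r) ?g"
      by (intro set_borel_measurableI borel_measurable_times borel_measurable_diff K_meas um bm) auto
    have "norm (?g y) \<le> norm (M * ((norm (y - x))\<^sup>2 * K (y - x)))" if "y \<in> ball x r" for y
      using mult_right_mono[OF taylor[OF that] K_nonneg] K_nonneg M by (simp add: abs_mult mult_ac)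
    then show "AE y in lebesgue. y \<in> ball x r \<longrightarrow> norm (?g y) \<le> norm (M * ((norm (y - x))\<^sup>2 * K (y - x)))"
      by blast
  qed
  \<comment> \<open>This is the limit: the outer part, plus the absolutely convergent integral of
    the Taylor remainder over the whole ball.\<close>
  define c where "c = (LINT y:- ball x r|lebesgue. ?f y) + (LINT y:ball x r|lebesgue. ?g y)"
  have eq: "(LINT y:- ball x \<epsilon>|lebesgue. ?f y) = c - (LINT y:ball x \<epsilon>|lebesgue. ?g y)"
    if \<epsilon>: "0 < \<epsilon>" "\<epsilon> < r" for \<epsilon>
  proof -
    let ?A = "ball x r - ball x \<epsilon>"
    have f: "set_integrable lebesgue (- ball x \<epsilon>) ?f" by (rule increment_K_outside_ball[OF u \<epsilon>(1)])
    have gA: "set_integrable lebesgue ?A ?g" by (rule set_integrable_subset[OF g]) auto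
    have gB: "set_integrable lebesgue (ball x \<epsilon>) ?g" by (rule set_integrable_subset[OF g]) (use \<epsilon> in auto)
    have "- ball x r \<union> ?A = - ball x \<epsilon>" using \<epsilon> by auto
    moreover have "(LINT y:- ball x r \<union> ?A|lebesgue. ?f y) = (LINT y:- ball x r|lebesgue. ?f y) + (LINT y:?A|lebesgue. ?f y)"
      by (rule set_integral_Un; (rule set_integrable_subset[OF f])?) (use \<epsilon> in auto)
    moreover have "(LINT y:?A|lebesgue. ?f y) = (LINT y:?A|lebesgue. ?g y + (b \<bullet> (y - x)) * K (y - x))"
      by (simp add: algebra_simps)
    moreover have "\<dots> = (LINT y:?A|lebesgue. ?g y)"
      using set_integral_add(2)[OF gA odd_integral(1)[OF \<epsilon>(1), of x r b]] odd_integral(2)[OF \<epsilon>(1), of x r b] by simp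
    moreover have "(LINT y:?A \<union> ball x \<epsilon>|lebesgue. ?g y) = (LINT y:?A|lebesgue. ?g y) + (LINT y:ball x \<epsilon>|lebesgue. ?g y)"
      by (rule set_integral_Un[OF _ gA gB]) auto
    moreover have "?A \<union> ball x \<epsilon> = ball x r" using \<epsilon> by auto
    ultimately show ?thesis by (simp add: c_def)
  qed
  have "((\<lambda>\<epsilon>. c - (LINT y:ball x \<epsilon>|lebesgue. ?g y)) \<longlongrightarrow> c - 0) (at_right 0)"
    by (intro tendsto_diff tendsto_const set_integral_shrinking_ball[OF g r])
  moreover have "eventually (\<lambda>\<epsilon>. c - (LINT y:ball x \<epsilon>|lebesgue. ?g y) = (LINT y:- ball x \<epsilon>|lebesgue. ?f y)) (at_right 0)"
    using eventually_at_right_less[of 0] eventually_at_right_real[OF r]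
    by eventually_elim (simp add: eq)
  ultimately have "((\<lambda>\<epsilon>. LINT y:- ball x \<epsilon>|lebesgue. ?f y) \<longlongrightarrow> c - 0) (at_right 0)"
    by (rule Lim_transform_eventually)
  then show ?thesis by (rule that)
qed

text \<open>The ball around \<open>x\<close> that reaches to the hyperplane lies in
  \<open>\<Sigma>\<close>, so the opposite half-space avoids the singularity. Everything there is
  integrable and can be carried to \<open>\<Sigma>\<close> by the measure preserving
  reflection.\<close>

lemma reflected_K_integrable:
  assumes x: "x \<in> \<Sigma>"
  shows "set_integrable lebesgue \<Sigma> (\<lambda>y. K (R y - x))"
    and "u \<in> Ls s \<Longrightarrow> \<forall>y\<in>\<Sigma>. u (R y) = - u y \<Longrightarrow> set_integrable lebesgue \<Sigma> (\<lambda>y. (u y - a) * K (R y - x))"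
    and "u \<in> Ls s \<Longrightarrow> \<forall>y\<in>\<Sigma>. u (R y) = - u y \<Longrightarrow>
      (LINT y:{y. y \<bullet> e < t}|lebesgue. (u y - a) * K (y - x)) = (LINT y:\<Sigma>|lebesgue. (- u y - a) * K (R y - x))"
proof -
  note R = reflect_preserves_lebesgue[OF e, of t]
  have d: "x \<bullet> e - t > 0" using x by simp
  have "{y. y \<bullet> e < t} \<inter> ball x (x \<bullet> e - t) = {}"
    using ball_subset_\<Sigma>[of "x \<bullet> e - t" x] by fastforce
  then have sub: "{y. y \<bullet> e < t} \<subseteq> - ball x (x \<bullet> e - t)" by blast
  have pre: "R -` {y. y \<bullet> e < t} = \<Sigma>" using reflect_side by blast
  have "set_integrable lebesgue {y. y \<bullet> e < t} (\<lambda>y. K (y - x))"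
    by (rule set_integrable_subset[OF K_outside_ball(1)[OF d] sets_\<Sigma>(2) sub])
  from set_integral_measure_preserving(1)[OF R this]
  show 1: "set_integrable lebesgue \<Sigma> (\<lambda>y. K (R y - x))" unfolding pre .
  assume u: "u \<in> Ls s" and anti: "\<forall>y\<in>\<Sigma>. u (R y) = - u y"
  have *: "set_integrable lebesgue {y. y \<bullet> e < t} (\<lambda>y. (u y - a) * K (y - x))" for a
    by (rule set_integrable_subset[OF increment_K_outside_ball[OF u d] sets_\<Sigma>(2) sub])
  have eq: "(u (R y) - a) * K (R y - x) = (- u y - a) * K (R y - x)" if "y \<in> \<Sigma>" for y a
    using anti that by simp
  have **: "set_integrable lebesgue \<Sigma> (\<lambda>y. (- u y - a) * K (R y - x))" for a
    using set_integral_measure_preserving(1)[OF R *[of a]] unfolding pre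
    by (subst (asm) set_integrable_cong[OF refl refl eq]) auto
  show "set_integrable lebesgue \<Sigma> (\<lambda>y. (u y - a) * K (R y - x))"
    \<comment> \<open>Negating \<open>- u y + a\<close> restores \<open>u y - a\<close>.\<close>
    using set_integrable_mult_right[OF **[of "- a"], of "-1"] by (simp add: algebra_simps)
  show "(LINT y:{y. y \<bullet> e < t}|lebesgue. (u y - a) * K (y - x)) = (LINT y:\<Sigma>|lebesgue. (- u y - a) * K (R y - x))"
  proof -
    have "(LINT y:\<Sigma>|lebesgue. (u (R y) - a) * K (R y - x)) = (LINT y:\<Sigma>|lebesgue. (- u y - a) * K (R y - x))"
      by (rule set_lebesgue_integral_cong[OF sets_\<Sigma>(1)]) (intro allI impI eq)
    then show ?thesis using set_integral_measure_preserving(2)[OF R *[of a]] unfolding pre by simp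
  qed
qed

text \<open>The far half-space is folded onto \<open>\<Sigma>\<close> by antisymmetry, where the
  increment becomes \<open>- (u y - u x) - 2 * u x\<close>; the hyperplane is a null set. The fold
  covers all of \<open>\<Sigma>\<close>, including the small ball, which accounts for the extra
  integral over \<open>ball x \<epsilon>\<close> on the left.\<close>

lemma pv_decomposition:
  assumes u: "u \<in> Ls s" and anti: "\<forall>y\<in>\<Sigma>. u (R y) = - u y" and x: "x \<in> \<Sigma>"
    and \<epsilon>: "0 < \<epsilon>" "\<epsilon> \<le> x \<bullet> e - t"
  shows "(LINT y:- ball x \<epsilon>|lebesgue. (u y - u x) * K (y - x)) + (LINT y:ball x \<epsilon>|lebesgue. (u y - u x) * K (R y - x)) =
    (LINT y:\<Sigma> - ball x \<epsilon>|lebesgue. (u y - u x) * (K (y - x) - K (R y - x))) - 2 * u x * (LINT y:\<Sigma>|lebesgue. K (R y - x))"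
proof -
  let ?f = "\<lambda>y. (u y - u x) * K (y - x)" and ?h = "\<lambda>y. (u y - u x) * K (R y - x)"
  let ?B = "ball x \<epsilon>" and ?S' = "{y. y \<bullet> e < t}"
  have B: "?B \<subseteq> \<Sigma>" by (rule ball_subset_\<Sigma>[OF \<epsilon>(2)])
  have f: "set_integrable lebesgue (- ?B) ?f" by (rule increment_K_outside_ball[OF u \<epsilon>(1)])
  have h: "set_integrable lebesgue \<Sigma> ?h" by (rule reflected_K_integrable(2)[OF x u anti])
  have hB: "set_integrable lebesgue ?B ?h" by (rule set_integrable_subset[OF h _ B]) auto
  have hS: "set_integrable lebesgue (\<Sigma> - ?B) ?h" by (rule set_integrable_subset[OF h]) auto
  have fS: "set_integrable lebesgue (\<Sigma> - ?B) ?f" by (rule set_integrable_subset[OF f]) auto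
  have fS': "set_integrable lebesgue ?S' ?f" by (rule set_integrable_subset[OF f]) (use B in auto)
  have "(LINT y:- ?B|lebesgue. ?f y) = (LINT y:(\<Sigma> - ?B) \<union> ?S'|lebesgue. ?f y)"
  proof (rule set_integral_cong_set)
    show "set_borel_measurable lebesgue (- ?B) ?f"
      using f unfolding set_integrable_def set_borel_measurable_def by (rule borel_measurable_integrable)
    have "set_integrable lebesgue ((\<Sigma> - ?B) \<union> ?S') ?f"
      by (rule set_integrable_Un[OF fS fS']) auto
    then show "set_borel_measurable lebesgue ((\<Sigma> - ?B) \<union> ?S') ?f"
      unfolding set_integrable_def set_borel_measurable_def by (rule borel_measurable_integrable)
    show "AE y in lebesgue. y \<in> (\<Sigma> - ?B) \<union> ?S' \<longleftrightarrow> y \<in> - ?B"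
      using hyperplane_AE[OF e, of t] by (rule AE_mp) (use B in \<open>auto intro!: AE_I2\<close>)
  qed
  also have "\<dots> = (LINT y:\<Sigma> - ?B|lebesgue. ?f y) + (LINT y:?S'|lebesgue. ?f y)"
    by (rule set_integral_Un[OF _ fS fS']) auto
  also have "(LINT y:?S'|lebesgue. ?f y) = (LINT y:\<Sigma>|lebesgue. (- u y - u x) * K (R y - x))"
    by (rule reflected_K_integrable(3)[OF x u anti])
  also have "\<dots> = (LINT y:\<Sigma>|lebesgue. (- 1) * ?h y - 2 * u x * K (R y - x))"
    by (simp add: algebra_simps)
  also have "\<dots> = - (LINT y:\<Sigma>|lebesgue. ?h y) - 2 * u x * (LINT y:\<Sigma>|lebesgue. K (R y - x))"
    unfolding set_integral_diff(2)[OF set_integrable_mult_right[OF h, of "- 1"]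
        set_integrable_mult_right[OF reflected_K_integrable(1)[OF x], of "2 * u x"]]
    by (simp only: set_integral_mult_right)
  also have "(LINT y:\<Sigma>|lebesgue. ?h y) = (LINT y:(\<Sigma> - ?B) \<union> ?B|lebesgue. ?h y)"
    using B by (simp add: Un_absorb2)
  also have "\<dots> = (LINT y:\<Sigma> - ?B|lebesgue. ?h y) + (LINT y:?B|lebesgue. ?h y)"
    by (rule set_integral_Un[OF _ hS hB]) auto
  finally have "(LINT y:- ?B|lebesgue. ?f y) + (LINT y:?B|lebesgue. ?h y) =
      ((LINT y:\<Sigma> - ?B|lebesgue. ?f y) - (LINT y:\<Sigma> - ?B|lebesgue. ?h y)) - 2 * u x * (LINT y:\<Sigma>|lebesgue. K (R y - x))"
    by simp
  also have "(LINT y:\<Sigma> - ?B|lebesgue. ?f y) - (LINT y:\<Sigma> - ?B|lebesgue. ?h y) = (LINT y:\<Sigma> - ?B|lebesgue. ?f y - ?h y)"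
    by (rule set_integral_diff(2)[OF fS hS, symmetric])
  also have "(\<lambda>y. ?f y - ?h y) = (\<lambda>y. (u y - u x) * (K (y - x) - K (R y - x)))"
    by (simp add: fun_eq_iff algebra_simps)
  finally show ?thesis .
qed

text \<open>The extra ball integral of the decomposition tends to 0, so bounds on the folded
  expression pass to the limit. Convergence to \<open>l\<close> is assumed because
  \<open>pv_integral\<close> is a \<open>Lim\<close>, informative only when the limit
  exists.\<close>

lemma pv_ge:
  assumes u: "u \<in> Ls s" and anti: "\<forall>y\<in>\<Sigma>. u (R y) = - u y" and x: "x \<in> \<Sigma>"
    and lim: "((\<lambda>\<epsilon>. LINT y:- ball x \<epsilon>|lebesgue. (u y - u x) * K (y - x)) \<longlongrightarrow> l) (at_right 0)"
    and \<epsilon>0: "\<epsilon>0 > 0"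
    and L: "\<And>\<epsilon>. 0 < \<epsilon> \<Longrightarrow> \<epsilon> < \<epsilon>0 \<Longrightarrow> L \<le> (LINT y:\<Sigma> - ball x \<epsilon>|lebesgue. (u y - u x) * (K (y - x) - K (R y - x)))
      - 2 * u x * (LINT y:\<Sigma>|lebesgue. K (R y - x))"
  shows "L \<le> pv_integral x (\<lambda>y. (u y - u x) * K (y - x))"
proof -
  have d: "x \<bullet> e - t > 0" using x by simp
  have "set_integrable lebesgue (ball x (x \<bullet> e - t)) (\<lambda>y. (u y - u x) * K (R y - x))"
    by (rule set_integrable_subset[OF reflected_K_integrable(2)[OF x u anti] _ ball_subset_\<Sigma>]) auto
  from set_integral_shrinking_ball[OF this d]
  have "((\<lambda>\<epsilon>. (LINT y:- ball x \<epsilon>|lebesgue. (u y - u x) * K (y - x)) + (LINT y:ball x \<epsilon>|lebesgue. (u y - u x) * K (R y - x)))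
      \<longlongrightarrow> l + 0) (at_right 0)"
    by (intro tendsto_add lim)
  moreover have "eventually (\<lambda>\<epsilon>. L \<le> (LINT y:- ball x \<epsilon>|lebesgue. (u y - u x) * K (y - x)) +
      (LINT y:ball x \<epsilon>|lebesgue. (u y - u x) * K (R y - x))) (at_right 0)"
    using eventually_at_right_real[OF d] eventually_at_right_real[OF \<epsilon>0]
    by eventually_elim (use L in \<open>simp add: pv_decomposition[OF u anti x]\<close>)
  ultimately have "L \<le> l + 0" by (rule tendsto_lowerbound) simp
  moreover have "pv_integral x (\<lambda>y. (u y - u x) * K (y - x)) = l"
    unfolding pv_integral_def by (rule tendsto_Lim[OF _ lim]) simp
  ultimately show ?thesis by simp
qed

text \<open>Near \<open>z\<close> the quadratic term is paid for by the squared distance. The linear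
  term cancels against the even kernel, and against the reflected kernel it costs at most
  \<open>\<eta>\<close> times that kernel. Far from \<open>z\<close> the loss is at most
  \<open>\<kappa>\<close> times the kernel tail.\<close>

lemma pv_ge_near_min:
  assumes u: "u \<in> Ls s" and anti: "\<forall>y\<in>\<Sigma>. u (R y) = - u y" and z: "z \<in> \<Sigma>"
    and lim: "((\<lambda>\<epsilon>. LINT y:- ball z \<epsilon>|lebesgue. (u y - u z) * K (y - z)) \<longlongrightarrow> l) (at_right 0)"
    and \<rho>: "0 < \<rho>" "\<rho> \<le> z \<bullet> e - t" and a: "a \<ge> 0" and \<kappa>: "\<kappa> \<ge> 0" and b: "norm b * \<rho> \<le> \<eta>"
    and near: "\<And>y. y \<in> ball z \<rho> \<Longrightarrow> - (a * (norm (y - z))\<^sup>2 + b \<bullet> (y - z)) \<le> u y - u z"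
    and far: "\<And>y. y \<in> \<Sigma> - ball z \<rho> \<Longrightarrow> - \<kappa> \<le> u y - u z"
  shows "- (a * H * (LINT v:ball 0 \<rho>|lebesgue. norm (v :: real ^ 'n) powr (2 - N)))
      - \<kappa> * H * (LINT v:- ball 0 \<rho>|lebesgue. norm (v :: real ^ 'n) powr - N)
      - (2 * u z + \<eta>) * (LINT y:\<Sigma>|lebesgue. K (R y - z))
    \<le> pv_integral z (\<lambda>y. (u y - u z) * K (y - z))"
proof (rule pv_ge[OF u anti z lim \<rho>(1)])
  fix \<epsilon> assume \<epsilon>: "0 < \<epsilon>" "\<epsilon> < \<rho>"
  let ?F = "\<lambda>y. (u y - u z) * (K (y - z) - K (R y - z))"
  let ?A = "ball z \<rho> - ball z \<epsilon>" and ?C = "\<Sigma> - ball z \<rho>"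
  let ?q = "\<lambda>y. (norm (y - z))\<^sup>2 * K (y - z)" and ?o = "\<lambda>y. (b \<bullet> (y - z)) * K (y - z)"
  let ?k = "\<lambda>y. K (R y - z)"
  have B: "ball z \<rho> \<subseteq> \<Sigma>" by (rule ball_subset_\<Sigma>[OF \<rho>(2)])
  have F: "set_integrable lebesgue (\<Sigma> - ball z \<epsilon>) ?F"
  proof -
    have "set_integrable lebesgue (\<Sigma> - ball z \<epsilon>) (\<lambda>y. (u y - u z) * K (y - z))"
      by (rule set_integrable_subset[OF increment_K_outside_ball[OF u \<epsilon>(1)]]) auto
    moreover have "set_integrable lebesgue (\<Sigma> - ball z \<epsilon>) (\<lambda>y. (u y - u z) * K (R y - z))"
      by (rule set_integrable_subset[OF reflected_K_integrable(2)[OF z u anti]]) auto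
    ultimately show ?thesis unfolding right_diff_distrib by (rule set_integral_diff(1))
  qed
  have FA: "set_integrable lebesgue ?A ?F" by (rule set_integrable_subset[OF F]) (use B in auto)
  have FC: "set_integrable lebesgue ?C ?F" by (rule set_integrable_subset[OF F]) (use \<epsilon> in auto)
  have q: "set_integrable lebesgue (ball z \<rho>) ?q" by (rule K_inside_ball(1)[OF \<rho>(1)])
  have qA: "set_integrable lebesgue ?A ?q" by (rule set_integrable_subset[OF q]) auto
  have oA: "set_integrable lebesgue ?A ?o" by (rule odd_integral(1)[OF \<epsilon>(1)])
  have k: "set_integrable lebesgue \<Sigma> ?k" by (rule reflected_K_integrable(1)[OF z])
  have kA: "set_integrable lebesgue ?A ?k" by (rule set_integrable_subset[OF k]) (use B in auto)
  have K: "set_integrable lebesgue (- ball z \<rho>) (\<lambda>y. K (y - z))" by (rule K_outside_ball(1)[OF \<rho>(1)])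
  have KC: "set_integrable lebesgue ?C (\<lambda>y. K (y - z))" by (rule set_integrable_subset[OF K]) auto
  have \<eta>: "\<eta> \<ge> 0" using b \<rho> by (meson norm_ge_zero mult_nonneg_nonneg less_imp_le order_trans)
  have "(LINT y:?A|lebesgue. (- a) * ?q y + (- 1) * ?o y + (- \<eta>) * ?k y) \<le> (LINT y:?A|lebesgue. ?F y)"
  proof (rule set_integral_mono[OF _ FA])
    show "set_integrable lebesgue ?A (\<lambda>y. (- a) * ?q y + (- 1) * ?o y + (- \<eta>) * ?k y)"
      by (intro set_integral_add(1) set_integrable_mult_right qA oA kA)
    fix y assume y: "y \<in> ?A"
    define p where "p = a * (norm (y - z))\<^sup>2 + b \<bullet> (y - z)"
    have yS: "t < y \<bullet> e" using y B by auto
    have "z \<noteq> y" using y \<epsilon> by auto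
    have "norm b * norm (y - z) \<le> norm b * \<rho>"
      using y by (intro mult_left_mono) (auto simp: dist_norm norm_minus_commute)
    then have "- \<eta> \<le> b \<bullet> (y - z)" using b Cauchy_Schwarz_ineq2[of b "y - z"] by linarith
    then have "- \<eta> \<le> p" using a by (simp add: p_def add_increasing)
    then have 1: "- \<eta> * ?k y \<le> p * ?k y" using K_nonneg by (rule mult_right_mono)
    have "- p * (K (y - z) - ?k y) \<le> ?F y"
      using near[of y] K_reflect[OF _ yS \<open>z \<noteq> y\<close>] z y by (intro mult_right_mono) (auto simp: p_def)
    then show "(- a) * ?q y + (- 1) * ?o y + (- \<eta>) * ?k y \<le> ?F y"
      using 1 by (simp add: p_def algebra_simps)
  qed
  also have "(LINT y:?A|lebesgue. (- a) * ?q y + (- 1) * ?o y + (- \<eta>) * ?k y) =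
      - a * (LINT y:?A|lebesgue. ?q y) - \<eta> * (LINT y:?A|lebesgue. ?k y)"
  proof -
    have "set_integrable lebesgue ?A (\<lambda>y. (- a) * ?q y)" "set_integrable lebesgue ?A (\<lambda>y. (- 1) * ?o y)"
      "set_integrable lebesgue ?A (\<lambda>y. (- \<eta>) * ?k y)"
      by (intro set_integrable_mult_right qA oA kA)+
    note i = this
    show ?thesis
      unfolding set_integral_add(2)[OF set_integral_add(1)[OF i(1,2)] i(3)] set_integral_add(2)[OF i(1,2)]
        set_integral_mult_right odd_integral(2)[OF \<epsilon>(1), of z \<rho> b] by simp
  qed
  finally have 1: "- a * (LINT y:?A|lebesgue. ?q y) - \<eta> * (LINT y:?A|lebesgue. ?k y) \<le> (LINT y:?A|lebesgue. ?F y)" .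
  have "(LINT y:?A|lebesgue. ?q y) \<le> (LINT y:ball z \<rho>|lebesgue. ?q y)"
    by (rule set_integral_subset_mono[OF q]) (use K_nonneg in auto)
  also have "\<dots> \<le> H * (LINT v:ball 0 \<rho>|lebesgue. norm (v :: real ^ 'n) powr (2 - N))"
    by (rule K_inside_ball(2)[OF \<rho>(1)])
  finally have 2: "a * (LINT y:?A|lebesgue. ?q y) \<le> a * (H * (LINT v:ball 0 \<rho>|lebesgue. norm (v :: real ^ 'n) powr (2 - N)))"
    using a by (rule mult_left_mono)
  have "(LINT y:?A|lebesgue. ?k y) \<le> (LINT y:\<Sigma>|lebesgue. ?k y)"
    by (rule set_integral_subset_mono[OF k]) (use K_nonneg B in auto)
  then have 3: "\<eta> * (LINT y:?A|lebesgue. ?k y) \<le> \<eta> * (LINT y:\<Sigma>|lebesgue. ?k y)"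
    using \<eta> by (rule mult_left_mono)
  have "(LINT y:?C|lebesgue. (- \<kappa>) * K (y - z)) \<le> (LINT y:?C|lebesgue. ?F y)"
  proof (rule set_integral_mono[OF _ FC])
    show "set_integrable lebesgue ?C (\<lambda>y. (- \<kappa>) * K (y - z))" using KC by (rule set_integrable_mult_right)
    fix y assume y: "y \<in> ?C"
    have "z \<noteq> y" using y \<rho> by auto
    \<comment> \<open>Omitting the nonnegative reflected kernel only lowers the bound and leaves the
      tail of \<open>K\<close> alone.\<close>
    have "- \<kappa> * K (y - z) \<le> - \<kappa> * (K (y - z) - ?k y)"
      using \<kappa> K_nonneg by (intro mult_left_mono_neg) auto
    also have "\<dots> \<le> ?F y"
      using far[OF y] K_reflect[OF _ _ \<open>z \<noteq> y\<close>] z y by (intro mult_right_mono) auto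
    finally show "(- \<kappa>) * K (y - z) \<le> ?F y" .
  qed
  then have 4: "- (\<kappa> * (LINT y:?C|lebesgue. K (y - z))) \<le> (LINT y:?C|lebesgue. ?F y)"
    by (simp only: set_integral_mult_right minus_mult_left)
  have "(LINT y:?C|lebesgue. K (y - z)) \<le> (LINT y:- ball z \<rho>|lebesgue. K (y - z))"
    by (rule set_integral_subset_mono[OF K]) (use K_nonneg in auto)
  also have "\<dots> \<le> H * (LINT v:- ball 0 \<rho>|lebesgue. norm (v :: real ^ 'n) powr - N)"
    by (rule K_outside_ball(2)[OF \<rho>(1)])
  finally have 5: "\<kappa> * (LINT y:?C|lebesgue. K (y - z)) \<le> \<kappa> * (H * (LINT v:- ball 0 \<rho>|lebesgue. norm (v :: real ^ 'n) powr - N))"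
    using \<kappa> by (rule mult_left_mono)
  have "?A \<union> ?C = \<Sigma> - ball z \<epsilon>" using B \<epsilon> by auto
  moreover have "(LINT y:?A \<union> ?C|lebesgue. ?F y) = (LINT y:?A|lebesgue. ?F y) + (LINT y:?C|lebesgue. ?F y)"
    by (rule set_integral_Un[OF _ FA FC]) auto
  ultimately have 6: "(LINT y:\<Sigma> - ball z \<epsilon>|lebesgue. ?F y) = (LINT y:?A|lebesgue. ?F y) + (LINT y:?C|lebesgue. ?F y)"
    by simp
  show "- (a * H * (LINT v:ball 0 \<rho>|lebesgue. norm (v :: real ^ 'n) powr (2 - N)))
      - \<kappa> * H * (LINT v:- ball 0 \<rho>|lebesgue. norm (v :: real ^ 'n) powr - N)
      - (2 * u z + \<eta>) * (LINT y:\<Sigma>|lebesgue. K (R y - z))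
    \<le> (LINT y:\<Sigma> - ball z \<epsilon>|lebesgue. ?F y) - 2 * u z * (LINT y:\<Sigma>|lebesgue. K (R y - z))"
    unfolding 6 using 1 2 3 4 5 by (simp add: algebra_simps)
qed

text \<open>Only the ball of radius \<open>d\<close> around \<open>z\<close> is kept,
  \<open>d\<close> being the distance of \<open>z\<close> to the hyperplane. The mirror image of
  \<open>z\<close> is at distance \<open>2 * d\<close>, so reflected points of the ball are within
  \<open>3 * d\<close> of \<open>z\<close>. The volume \<open>d powr n\<close> times
  \<open>d powr - N\<close> gives the power \<open>- 2 * s\<close>.\<close>

lemma reflected_K_integral_ge:
  assumes z: "z \<in> \<Sigma>" and h: "h \<ge> 0" "\<And>v. h * norm v powr - N \<le> K v"
  shows "h * 3 powr - N * unit_ball_vol (real CARD('n)) * (z \<bullet> e - t) powr (- 2 * s)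
    \<le> (LINT y:\<Sigma>|lebesgue. K (R y - z))"
proof -
  define d where "d = z \<bullet> e - t"
  have d: "d > 0" using z by (simp add: d_def)
  have B: "ball z d \<subseteq> \<Sigma>" by (rule ball_subset_\<Sigma>) (simp add: d_def)
  have k: "set_integrable lebesgue \<Sigma> (\<lambda>y. K (R y - z))" by (rule reflected_K_integrable(1)[OF z])
  have kB: "set_integrable lebesgue (ball z d) (\<lambda>y. K (R y - z))"
    by (rule set_integrable_subset[OF k _ B]) simp
  have ci: "set_integrable lebesgue (ball z d) (\<lambda>y. h * (3 * d) powr - N)"
    by (rule absolutely_integrable_on_const) simp
  have "h * (3 * d) powr - N * measure lebesgue (ball z d) = (LINT y:ball z d|lebesgue. h * (3 * d) powr - N)"
    unfolding set_lebesgue_integral_def by simp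
  also have "\<dots> \<le> (LINT y:ball z d|lebesgue. K (R y - z))"
  proof (rule set_integral_mono[OF ci kB])
    fix y assume y: "y \<in> ball z d"
    have "R z - z = - (2 * d) *\<^sub>R e" by (simp add: reflect_def d_def algebra_simps)
    then have "norm (R z - z) = 2 * d" using d e by simp
    moreover have "norm (R y - R z) \<le> d" using y by (simp add: reflect_dist[OF e] dist_norm norm_minus_commute)
    ultimately have le: "norm (R y - z) \<le> 3 * d"
      using norm_triangle_ineq[of "R y - R z" "R z - z"] by simp
    \<comment> \<open>\<open>R y\<close> and \<open>z\<close> lie on opposite sides, hence differ;
      this excludes the default value of \<open>0 powr - N\<close>, which is 0.\<close>
    have "y \<in> \<Sigma>" using y B by auto
    then have "R y \<noteq> z" using z e by (auto simp: reflect_inner dest: arg_cong[of _ _ "\<lambda>v. v \<bullet> e"])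
    then have "(3 * d) powr - N \<le> norm (R y - z) powr - N"
      using N_pos le by (intro powr_mono2') auto
    then have "h * (3 * d) powr - N \<le> h * norm (R y - z) powr - N" using h(1) by (rule mult_left_mono)
    also have "\<dots> \<le> K (R y - z)" by (rule h(2))
    finally show "h * (3 * d) powr - N \<le> K (R y - z)" .
  qed
  also have "\<dots> \<le> (LINT y:\<Sigma>|lebesgue. K (R y - z))"
    by (rule set_integral_subset_mono[OF k _ B]) (use K_nonneg in auto)
  finally have "h * (3 * d) powr - N * measure lebesgue (ball z d) \<le> (LINT y:\<Sigma>|lebesgue. K (R y - z))" .
  moreover have "measure lebesgue (ball z d) = unit_ball_vol (real CARD('n)) * d powr real CARD('n)"
    using d content_ball[of d z] by (simp add: powr_realpow)
  moreover have "(3 * d) powr - N = 3 powr - N * d powr - N" using d by (simp add: powr_mult)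
  moreover have "d powr - N * d powr real CARD('n) = d powr (- 2 * s)"
    by (simp add: powr_add[symmetric] N)
  ultimately show ?thesis by (simp add: d_def mult_ac)
qed

end

section \<open>Kernels of admissible matrices\<close>

text \<open>A lower bound, uniform over the admissible matrices, for \<open>K (y - x) - K (y' - x)\<close> with
  \<open>y'\<close> the reflection of \<open>y\<close>.\<close>

definition reflection_gap :: "real \<Rightarrow> real \<Rightarrow> real \<Rightarrow> real ^ 'n \<Rightarrow> real \<Rightarrow> real ^ 'n \<Rightarrow> real ^ 'n \<Rightarrow> real" where
  "reflection_gap \<theta> \<Theta> N e t x y = \<theta> powr N * norm (y - x) powr - N *
     (1 - sqrt (1 + 4 * (y \<bullet> e - t) * (x \<bullet> e - t) * \<theta>\<^sup>2 / (\<Theta>\<^sup>2 * (norm (y - x))\<^sup>2)) powr - N)"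

lemma reflection_gap_pos:
  assumes "0 < \<theta>" "0 < \<Theta>" "0 < N" "t < x \<bullet> e" "t < y \<bullet> e" "x \<noteq> y"
  shows "0 < reflection_gap \<theta> \<Theta> N e t x y"
proof -
  define \<tau> where "\<tau> = 4 * (y \<bullet> e - t) * (x \<bullet> e - t) * \<theta>\<^sup>2 / (\<Theta>\<^sup>2 * (norm (y - x))\<^sup>2)"
  have "\<tau> > 0" unfolding \<tau>_def using assms by (intro divide_pos_pos mult_pos_pos) auto
  then have "sqrt (1 + \<tau>) powr - N < 1" using assms by (simp add: powr_less_one)
  then show ?thesis unfolding reflection_gap_def \<tau>_def[symmetric] using assms by simp
qed

lemma admissible_kernel_bounds:
  fixes A :: "real ^ 'n ^ 'n"
  assumes A: "A \<in> admissible \<theta> \<Theta> e" and \<theta>: "0 < \<theta>" "\<theta> \<le> \<Theta>" and N: "N > 0"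
  shows "1 / norm (matrix_inv A *v v) powr N \<le> \<Theta> powr N * norm v powr - N"
    and "\<theta> powr N * norm v powr - N \<le> 1 / norm (matrix_inv A *v v) powr N"
proof -
  note b = admissible_inv_norm_bounds[OF A \<theta>, of v]
  have "1 / norm (matrix_inv A *v v) powr N \<le> \<Theta> powr N * norm v powr - N \<and>
    \<theta> powr N * norm v powr - N \<le> 1 / norm (matrix_inv A *v v) powr N"
  proof (cases "v = 0")
    case False
    then have v: "norm v > 0" by simp
    then have B: "norm (matrix_inv A *v v) > 0" using b(2) \<theta> by (smt (verit) divide_pos_pos)
    have "1 / norm (matrix_inv A *v v) powr N = norm (matrix_inv A *v v) powr - N"
      by (simp add: powr_minus_divide)
    moreover have "norm (matrix_inv A *v v) powr - N \<le> (norm v / \<Theta>) powr - N"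
      using b(2) v \<theta> N by (intro powr_mono2') auto
    moreover have "(norm v / \<theta>) powr - N \<le> norm (matrix_inv A *v v) powr - N"
      using b(1) B N by (intro powr_mono2') auto
    moreover have "(norm v / c) powr - N = c powr N * norm v powr - N" if "c > 0" for c
      using that v by (simp add: powr_divide powr_minus field_simps)
    ultimately show ?thesis using \<theta> by simp
  \<comment> \<open>At \<open>v = 0\<close> all three expressions have the default value 0.\<close>
  qed simp
  then show "1 / norm (matrix_inv A *v v) powr N \<le> \<Theta> powr N * norm v powr - N"
    and "\<theta> powr N * norm v powr - N \<le> 1 / norm (matrix_inv A *v v) powr N" by auto
qed

text \<open>The additive gain in the squared norm under reflection becomes a multiplicative one,
  \<open>\<alpha>\<^sup>2 * (1 + \<tau>) \<le> \<beta>\<^sup>2\<close>, through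
  \<open>\<alpha> \<le> r / \<theta>\<close>. The same inequality bounds
  \<open>\<alpha> powr - N\<close> from below, which removes the remaining dependence on
  \<open>A\<close>.\<close>

lemma admissible_kernel_gap:
  fixes A :: "real ^ 'n ^ 'n"
  assumes A: "A \<in> admissible \<theta> \<Theta> e" and \<theta>: "0 < \<theta>" "\<theta> \<le> \<Theta>" and e: "norm e = 1" and N: "N > 0"
    and side: "t < x \<bullet> e" "t < y \<bullet> e" and "x \<noteq> y"
  shows "reflection_gap \<theta> \<Theta> N e t x y \<le>
    1 / norm (matrix_inv A *v (y - x)) powr N - 1 / norm (matrix_inv A *v (reflect e t y - x)) powr N"
proof -
  define r \<alpha> \<beta> where "r = norm (y - x)" and "\<alpha> = norm (matrix_inv A *v (y - x))"
    and "\<beta> = norm (matrix_inv A *v (reflect e t y - x))"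
  define \<tau> where "\<tau> = 4 * (y \<bullet> e - t) * (x \<bullet> e - t) * \<theta>\<^sup>2 / (\<Theta>\<^sup>2 * r\<^sup>2)"
  have r: "r > 0" using \<open>x \<noteq> y\<close> by (simp add: r_def)
  have \<tau>: "\<tau> > 0" unfolding \<tau>_def using side \<theta> r by (intro divide_pos_pos mult_pos_pos) auto
  have \<alpha>le: "\<alpha> \<le> r / \<theta>" and "r / \<Theta> \<le> \<alpha>"
    unfolding \<alpha>_def r_def by (rule admissible_inv_norm_bounds[OF A \<theta>])+
  then have \<alpha>: "\<alpha> > 0" using r \<theta> by (smt (verit) divide_pos_pos)
  have "\<alpha>\<^sup>2 * (1 + \<tau>) \<le> \<alpha>\<^sup>2 + \<tau> * (r / \<theta>)\<^sup>2"
    using mult_left_mono[OF power_mono[OF \<alpha>le, of 2], of \<tau>] \<tau> \<alpha> by (simp add: algebra_simps)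
  also have "\<tau> * (r / \<theta>)\<^sup>2 = 4 * (y \<bullet> e - t) * (x \<bullet> e - t) / \<Theta>\<^sup>2"
    using r \<theta> by (simp add: \<tau>_def power_divide)
  also have "\<alpha>\<^sup>2 + \<dots> \<le> \<beta>\<^sup>2"
    unfolding \<alpha>_def \<beta>_def by (rule admissible_inv_reflect[OF A \<theta> e side])
  finally have "(\<alpha> * sqrt (1 + \<tau>))\<^sup>2 \<le> \<beta>\<^sup>2" using \<tau> by (simp add: power_mult_distrib)
  then have "\<alpha> * sqrt (1 + \<tau>) \<le> \<beta>" by (rule power2_le_imp_le) (simp add: \<beta>_def)
  then have "\<beta> powr - N \<le> (\<alpha> * sqrt (1 + \<tau>)) powr - N"
    using \<alpha> \<tau> N by (intro powr_mono2') auto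
  also have "\<dots> = \<alpha> powr - N * sqrt (1 + \<tau>) powr - N" using \<alpha> \<tau> by (subst powr_mult) auto
  finally have "\<alpha> powr - N * (1 - sqrt (1 + \<tau>) powr - N) \<le> \<alpha> powr - N - \<beta> powr - N"
    by (simp add: algebra_simps)
  moreover have "\<theta> powr N * r powr - N * (1 - sqrt (1 + \<tau>) powr - N) \<le> \<alpha> powr - N * (1 - sqrt (1 + \<tau>) powr - N)"
  proof (rule mult_right_mono)
    show "\<theta> powr N * r powr - N \<le> \<alpha> powr - N"
      using admissible_kernel_bounds(2)[OF A \<theta> N, of "y - x"] by (simp add: r_def \<alpha>_def powr_minus_divide)
    show "0 \<le> 1 - sqrt (1 + \<tau>) powr - N"
      using powr_less_one[of "sqrt (1 + \<tau>)" "- N"] \<tau> N by simp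
  qed
  ultimately show ?thesis
    unfolding reflection_gap_def r_def[symmetric] \<tau>_def[symmetric] \<alpha>_def[symmetric] \<beta>_def[symmetric]
    by (simp add: powr_minus_divide)
qed

lemma admissible_reflected_kernel:
  fixes A :: "real ^ 'n ^ 'n"
  assumes A: "A \<in> admissible \<theta> \<Theta> e" and \<theta>: "0 < \<theta>" "\<theta> \<le> \<Theta>" and e: "norm e = 1" and s: "0 < s" "s < 1"
    and N: "N = real CARD('n) + 2 * s"
  shows "reflected_kernel s t (\<Theta> powr N) N e (\<lambda>v. 1 / norm (matrix_inv A *v v) powr N)"
proof
  have Np: "N > 0" using s by (simp add: N add_nonneg_pos)
  have "(\<lambda>v. matrix_inv A *v v) \<in> borel_measurable borel"
    by (intro borel_measurable_continuous_onI linear_continuous_on linear_conv_bounded_linear[THEN iffD1]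
      matrix_vector_mul_linear)
  then show "(\<lambda>v. 1 / norm (matrix_inv A *v v) powr N) \<in> borel_measurable borel" by measurable
  show "1 / norm (matrix_inv A *v - v) powr N = 1 / norm (matrix_inv A *v v) powr N" for v
    by (simp add: linear_neg[OF matrix_vector_mul_linear])
  show "1 / norm (matrix_inv A *v v) powr N \<le> \<Theta> powr N * norm v powr - N" for v
    by (rule admissible_kernel_bounds(1)[OF A \<theta> Np])
  show "1 / norm (matrix_inv A *v (reflect e t y - x)) powr N \<le> 1 / norm (matrix_inv A *v (y - x)) powr N"
    if "t < x \<bullet> e" "t < y \<bullet> e" "x \<noteq> y" for x y
    using admissible_kernel_gap[OF A \<theta> e Np that] reflection_gap_pos[of \<theta> \<Theta> N t x e y] that \<theta> Np by simp
qed (use assms in auto)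

lemma Fs_ge:
  fixes u :: "real ^ 'n \<Rightarrow> real"
  assumes "\<theta> \<le> \<Theta>" "norm e = 1"
    and "\<And>A. A \<in> admissible \<theta> \<Theta> e \<Longrightarrow>
      L \<le> pv_integral x (\<lambda>y. (u y - u x) * (1 / norm (matrix_inv A *v (y - x)) powr (real CARD('n) + 2 * s)))"
  shows "L \<le> Fs s \<theta> \<Theta> e u x"
proof -
  have "mat \<theta> \<in> admissible \<theta> \<Theta> e" by (rule mat_admissible) (use assms in auto)
  then show ?thesis unfolding Fs_def by (intro cINF_greatest) (use assms(3) in auto)
qed

section \<open>Lower semicontinuous functions\<close>

lemma lsc_on_subset: "lsc_on S f \<Longrightarrow> T \<subseteq> S \<Longrightarrow> lsc_on T f"
  unfolding lsc_on_def by (meson at_le filter_leD subsetD)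

lemma lsc_on_add_continuous:
  fixes f g :: "'a::topological_space \<Rightarrow> real"
  assumes f: "lsc_on S f" and g: "continuous_on S g"
  shows "lsc_on S (\<lambda>x. f x + g x)"
  unfolding lsc_on_def
proof (intro ballI allI impI)
  fix x a assume x: "x \<in> S" and a: "a < f x + g x"
  define \<epsilon> where "\<epsilon> = (f x + g x - a) / 2"
  have \<epsilon>: "\<epsilon> > 0" using a by (simp add: \<epsilon>_def)
  have "eventually (\<lambda>y. f x - \<epsilon> < f y) (at x within S)" using f x \<epsilon> by (simp add: lsc_on_def)
  moreover have "eventually (\<lambda>y. g x - \<epsilon> < g y) (at x within S)"
    using g x \<epsilon> by (intro order_tendstoD(1)[of g "g x"]) (auto simp: continuous_on_def)
  ultimately show "eventually (\<lambda>y. a < f y + g y) (at x within S)"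
    by eventually_elim (simp add: \<epsilon>_def field_simps)
qed

text \<open>Far out in \<open>\<Omega>\<close> either there are no points or the lower limit keeps
  \<open>w\<close> above \<open>- 1\<close>; the rest lies in a compact set where a minimum exists.
  The alternative between bounded and unbounded \<open>\<Omega>\<close> enters the proof only
  through this bound.\<close>

lemma lsc_on_bounded_below:
  fixes w :: "'a::euclidean_space \<Rightarrow> real"
  assumes lsc: "lsc_on (closure \<Omega>) w"
    and "bounded \<Omega> \<or> Liminf (inf at_infinity (principal \<Omega>)) (\<lambda>x. ereal (w x)) \<ge> 0"
  obtains c where "\<And>x. x \<in> \<Omega> \<Longrightarrow> c \<le> w x"
proof -
  have "\<exists>b. \<forall>x\<in>\<Omega>. b \<le> norm x \<longrightarrow> - 1 < w x"
    using assms(2)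
  proof
    assume "bounded \<Omega>"
    then obtain b where "\<forall>x\<in>\<Omega>. norm x < b" by (auto simp: bounded_pos_less)
    then show ?thesis by (intro exI[of _ b]) auto
  next
    assume "Liminf (inf at_infinity (principal \<Omega>)) (\<lambda>x. ereal (w x)) \<ge> 0"
    then have "eventually (\<lambda>x. ereal (- 1) < ereal (w x)) (inf at_infinity (principal \<Omega>))"
      unfolding le_Liminf_iff by (metis ereal_less(6) neg_less_0_iff_less zero_ereal_def zero_less_one ereal_less_eq(3) less_ereal.simps(1))
    then show ?thesis by (auto simp: eventually_inf_principal eventually_at_infinity)
  qed
  then obtain b where b: "\<And>x. x \<in> \<Omega> \<Longrightarrow> b \<le> norm x \<Longrightarrow> - 1 < w x" by blast
  let ?S = "closure \<Omega> \<inter> cball 0 b"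
  have S: "compact ?S" by (intro closed_Int_compact) auto
  have "\<exists>c. \<forall>x\<in>?S. c \<le> w x"
  proof (cases "?S = {}")
    case False
    obtain z where "z \<in> ?S" "\<And>y. y \<in> ?S \<Longrightarrow> w z \<le> w y"
      using lsc_on_attains_inf[OF S False lsc_on_subset[OF lsc]] by blast
    then show ?thesis by blast
  qed blast
  then obtain c where c: "\<And>x. x \<in> ?S \<Longrightarrow> c \<le> w x" by blast
  have "min c (- 1) \<le> w x" if "x \<in> \<Omega>" for x
  proof (cases "b \<le> norm x")
    case False
    then have "x \<in> ?S" using that closure_subset[of \<Omega>] by auto
    then show ?thesis using c[of x] by linarith
  qed (use b[OF that] in linarith)
  then show ?thesis by (rule that)
qed

section \<open>The maximum principle\<close>

text \<open>The normal \<open>e\<close> points into the half-space; the other side is reached by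
  changing the signs of \<open>e\<close> and \<open>t\<close>. The sign conditions on
  \<open>Fs\<close> are left to the individual arguments.\<close>

locale antisymmetric_supersolution =
  fixes s \<theta> \<Theta> t :: real and e :: "real ^ 'n" and \<Omega> :: "(real ^ 'n) set" and w :: "real ^ 'n \<Rightarrow> real"
  assumes s: "0 < s" "s < 1" and \<theta>: "0 < \<theta>" "\<theta> \<le> \<Theta>" and e: "norm e = 1"
    and open_\<Omega>: "open \<Omega>" and \<Omega>: "\<And>x. x \<in> \<Omega> \<Longrightarrow> t < x \<bullet> e"
    and Ls: "w \<in> Ls s" and C11: "w \<in> C11_loc \<Omega>"
    and outside: "\<And>x. t < x \<bullet> e \<Longrightarrow> x \<notin> \<Omega> \<Longrightarrow> 0 \<le> w x"
    and antisymmetric: "\<And>x. t < x \<bullet> e \<Longrightarrow> w (reflect e t x) = - w x"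
begin

definition "n2s = real CARD('n) + 2 * s"

definition "kern A v = 1 / norm (matrix_inv (A :: real ^ 'n ^ 'n) *v v) powr n2s"

lemma n2s_pos: "n2s > 0"
  using s by (simp add: n2s_def add_nonneg_pos)

lemma \<Theta>_pos: "\<Theta> > 0"
  using \<theta> by simp

lemma reflected_kernel_kern: "A \<in> admissible \<theta> \<Theta> e \<Longrightarrow> reflected_kernel s t (\<Theta> powr n2s) n2s e (kern A)"
  unfolding kern_def[abs_def] by (rule admissible_reflected_kernel[OF _ \<theta> e s]) (simp_all add: n2s_def)

lemma pv_exists:
  assumes x: "x \<in> \<Omega>" and A: "A \<in> admissible \<theta> \<Theta> e"
  obtains l where "((\<lambda>\<epsilon>. LINT y:- ball x \<epsilon>|lebesgue. (w y - w x) * kern A (y - x)) \<longlongrightarrow> l) (at_right 0)"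
proof -
  obtain r M b where taylor: "r > 0" "M \<ge> 0"
    "\<And>y. y \<in> ball x r \<Longrightarrow> \<bar>w y - w x - b \<bullet> (y - x)\<bar> \<le> M * (norm (y - x))\<^sup>2"
    by (rule C11_loc_taylor[OF C11 open_\<Omega> x]) (rule that)
  show ?thesis
    by (rule reflected_kernel.pv_convergent[OF reflected_kernel_kern[OF A] Ls taylor(1,2)])
      (erule taylor(3), rule that)
qed

lemma Fs_ge_kern:
  assumes "\<And>A. A \<in> admissible \<theta> \<Theta> e \<Longrightarrow> L \<le> pv_integral x (\<lambda>y. (w y - w x) * kern A (y - x))"
  shows "L \<le> Fs s \<theta> \<Theta> e w x"
  by (rule Fs_ge[OF \<theta>(2) e]) (use assms in \<open>simp add: kern_def n2s_def\<close>)

text \<open>If \<open>w x0\<close> is close to the infimum \<open>- m\<close>, then adding a small multiple of \<open>\<bar>y - x0\<bar>\<^sup>2\<close>, scaled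
  by the distance \<open>D\<close> from \<open>x0\<close> to the hyperplane, produces an interior minimum \<open>z\<close> near \<open>x0\<close>. No
  compactness of \<open>\<Omega>\<close> and no control of \<open>w\<close> on the hyperplane is needed.\<close>

lemma perturbed_minimum:
  assumes lsc: "lsc_on (closure \<Omega>) w" and m: "m > 0" and \<delta>: "0 < \<delta>" "\<delta> < 1"
    and below: "\<And>x. x \<in> \<Omega> \<Longrightarrow> - m \<le> w x"
    and x0: "x0 \<in> \<Omega>" "w x0 < - (1 - \<delta>) * m"
  defines "\<rho> \<equiv> (x0 \<bullet> e - t) / 4"
  obtains z where "z \<in> \<Omega>" "w z < - (1 - \<delta>) * m" "\<rho> \<le> z \<bullet> e - t" "z \<bullet> e - t \<le> 5 * \<rho>" "norm (z - x0) \<le> \<rho>"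
    "\<And>y. y \<in> ball z \<rho> \<Longrightarrow> - (\<delta> * m / \<rho>\<^sup>2 * (norm (y - z))\<^sup>2 + (2 * (\<delta> * m / \<rho>\<^sup>2)) *\<^sub>R (z - x0) \<bullet> (y - z)) \<le> w y - w z"
proof -
  \<comment> \<open>Chosen so that \<open>a * \<rho>\<^sup>2 = \<delta> * m\<close>: at points of
    \<open>\<Omega>\<close> farther than \<open>\<rho>\<close> from \<open>x0\<close> the penalty
    lifts \<open>v\<close> to at least \<open>- m + \<delta> * m\<close>, which is above
    \<open>w x0\<close>.\<close>
  define a where "a = \<delta> * m / \<rho>\<^sup>2"
  have \<rho>: "\<rho> > 0" using \<Omega>[OF x0(1)] by (simp add: \<rho>_def)
  have a: "a > 0" using \<rho> m \<delta> by (simp add: a_def)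
  have D: "x0 \<bullet> e - t = 4 * \<rho>" by (simp add: \<rho>_def)
  have side: "\<bar>y \<bullet> e - x0 \<bullet> e\<bar> \<le> norm (y - x0)" for y
    using Cauchy_Schwarz_ineq2[of "y - x0" e] e by (simp add: inner_diff_left)
  have in_\<Sigma>: "t < y \<bullet> e" if "norm (y - x0) \<le> 2 * \<rho>" for y
    using side[of y] that D \<rho> by linarith
  define v where "v y = w y + a * (norm (y - x0))\<^sup>2" for y
  \<comment> \<open>The radius \<open>2 * \<rho>\<close> is half the distance to the hyperplane, so
    \<open>S\<close> stays inside the half-space. Points of \<open>S\<close> outside
    \<open>\<Omega>\<close> have \<open>w \<ge> 0\<close> and cannot minimise
    \<open>v\<close>.\<close>
  define S where "S = closure \<Omega> \<inter> cball x0 (2 * \<rho>)"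
  have "compact S" unfolding S_def by (intro closed_Int_compact) auto
  moreover have x0S: "x0 \<in> S" using x0 \<rho> closure_subset by (auto simp: S_def)
  moreover have "lsc_on S v" unfolding v_def
    by (intro lsc_on_add_continuous lsc_on_subset[OF lsc] continuous_intros) (auto simp: S_def)
  ultimately obtain z where z: "z \<in> S" and zmin: "\<And>y. y \<in> S \<Longrightarrow> v z \<le> v y"
    using lsc_on_attains_inf[of S v] by blast
  have vz: "v z \<le> w x0" using zmin[OF x0S] by (simp add: v_def)
  have wz: "w z \<le> w x0" using vz a unfolding v_def
    by (smt (verit) mult_nonneg_nonneg zero_le_power2)
  have neg: "w x0 < 0" using x0(2) \<delta> m by (smt (verit) mult_neg_pos)
  have z2: "norm (z - x0) \<le> 2 * \<rho>" using z by (simp add: S_def dist_norm norm_minus_commute)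
  have z\<Omega>: "z \<in> \<Omega>" using outside[OF in_\<Sigma>[OF z2]] wz neg by fastforce
  have "\<not> \<rho> < norm (z - x0)"
  proof
    assume "\<rho> < norm (z - x0)"
    then have "\<rho>\<^sup>2 \<le> (norm (z - x0))\<^sup>2" using \<rho> by (intro power_mono) auto
    then have "a * \<rho>\<^sup>2 \<le> a * (norm (z - x0))\<^sup>2" using a by simp
    moreover have "a * \<rho>\<^sup>2 = \<delta> * m" using \<rho> by (simp add: a_def)
    ultimately have "- m + \<delta> * m \<le> v z" using below[OF z\<Omega>] by (simp add: v_def)
    then show False using vz x0(2) by (simp add: algebra_simps)
  qed
  then have z1: "norm (z - x0) \<le> \<rho>" by simp
  show ?thesis
  proof
    show "z \<in> \<Omega>" "norm (z - x0) \<le> \<rho>" by fact+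
    show "w z < - (1 - \<delta>) * m" using wz x0(2) by linarith
    show "\<rho> \<le> z \<bullet> e - t" "z \<bullet> e - t \<le> 5 * \<rho>" using side[of z] z1 D \<rho> by linarith+
    fix y assume "y \<in> ball z \<rho>"
    then have "norm (y - z) < \<rho>" by (simp add: dist_norm norm_minus_commute)
    then have y: "norm (y - x0) \<le> 2 * \<rho>" using norm_triangle_ineq[of "y - z" "z - x0"] z1 by simp
    have "v z \<le> v y"
    proof (cases "y \<in> \<Omega>")
      case True
      then show ?thesis using zmin[of y] y closure_subset by (auto simp: S_def dist_norm norm_minus_commute)
    next
      case False
      then have "0 \<le> v y" using outside[OF in_\<Sigma>[OF y]] a by (simp add: v_def)
      then show ?thesis using vz neg by linarith
    qed
    \<comment> \<open>Recentring the penalty at \<open>z\<close> produces the linear term, with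
      coefficient vector \<open>(2 * a) *\<^sub>R (z - x0)\<close>.\<close>
    moreover have "(norm (y - x0))\<^sup>2 = (norm (z - x0))\<^sup>2 + (norm (y - z))\<^sup>2 + 2 * ((z - x0) \<bullet> (y - z))"
      using dot_norm[of "z - x0" "y - z"] by (simp add: field_simps)
    ultimately have "- (a * (norm (y - z))\<^sup>2 + a * (2 * ((z - x0) \<bullet> (y - z)))) \<le> w y - w z"
      by (simp add: v_def algebra_simps)
    then show "- (\<delta> * m / \<rho>\<^sup>2 * (norm (y - z))\<^sup>2 + (2 * (\<delta> * m / \<rho>\<^sup>2)) *\<^sub>R (z - x0) \<bullet> (y - z)) \<le> w y - w z"
      by (simp add: a_def[symmetric] mult.assoc mult.left_commute)
  qed
qed

text \<open>Every error term at the perturbed minimum is at most \<open>\<delta>\<close> times a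
  constant times \<open>m * \<rho> powr (- 2 * s)\<close>, while the zero-order term is at least a
  fixed multiple of the same quantity. The scale \<open>\<rho>\<close> thus drops out, and a small
  \<open>\<delta>\<close> makes the estimate positive uniformly in \<open>A\<close>.\<close>

lemma Fs_pos_somewhere:
  assumes lsc: "lsc_on (closure \<Omega>) w" and below: "\<And>x. x \<in> \<Omega> \<Longrightarrow> c0 \<le> w x"
    and neg: "x1 \<in> \<Omega>" "w x1 < 0"
  obtains z where "z \<in> \<Omega>" "w z < 0" "0 < Fs s \<theta> \<Theta> e w z"
proof -
  have "- n2s + real DIM(real ^ 'n) < 0" "2 - n2s + real DIM(real ^ 'n) > 0" using s by (simp_all add: n2s_def)
  note * = norm_powr_integral_outside_ball[OF this(1)] norm_powr_integral_ball[OF this(2)]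
  have ex: "- n2s + real DIM(real ^ 'n) = - 2 * s" "2 - n2s + real DIM(real ^ 'n) = 2 - 2 * s"
    by (simp_all add: n2s_def)
  obtain C2 where C2: "C2 \<ge> 0"
    "\<And>r. r > 0 \<Longrightarrow> (LINT v:- ball 0 r|lebesgue. norm (v :: real ^ 'n) powr - n2s) \<le> C2 * r powr (- 2 * s)"
    using *(1) unfolding ex by metis
  obtain C1 where C1: "C1 \<ge> 0"
    "\<And>r. r > 0 \<Longrightarrow> (LINT v:ball 0 r|lebesgue. norm (v :: real ^ 'n) powr (2 - n2s)) \<le> C1 * r powr (2 - 2 * s)"
    using *(2) unfolding ex by metis
  define H where "H = \<Theta> powr n2s"
  \<comment> \<open>The constant of \<open>reflected_K_integral_ge\<close>; the power of 5 comes
    from \<open>z \<bullet> e - t \<le> 5 * \<rho>\<close>.\<close>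
  define C where "C = \<theta> powr n2s * 3 powr - n2s * unit_ball_vol (real CARD('n)) * 5 powr (- 2 * s)"
  have H: "H > 0" using \<theta> by (simp add: H_def)
  have C: "C > 0" unfolding C_def using \<theta> by (intro mult_pos_pos unit_ball_vol_pos) auto
  define Q where "Q = H * (C1 + C2)"
  have Q: "Q \<ge> 0" using H C1 C2 by (simp add: Q_def)
  \<comment> \<open>The bound \<open>1 / 4\<close> ensures
    \<open>m \<le> - (2 * w z + 2 * \<delta> * m)\<close>; the other one keeps the errors below half
    of the main term.\<close>
  define \<delta> where "\<delta> = min (1 / 4) (C / (2 * Q + 1))"
  have \<delta>: "0 < \<delta>" "\<delta> \<le> 1 / 4" "\<delta> * Q \<le> C / 2"
  proof -
    show "0 < \<delta>" using C Q by (simp add: \<delta>_def)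
    show "\<delta> \<le> 1 / 4" unfolding \<delta>_def by (rule min.cobounded1)
    have "\<delta> * Q \<le> C / (2 * Q + 1) * Q" using Q by (intro mult_right_mono) (auto simp: \<delta>_def)
    also have "\<dots> \<le> C / 2" using C Q by (simp add: field_simps)
    finally show "\<delta> * Q \<le> C / 2" .
  qed
  define m where "m = - Inf (w ` \<Omega>)"
  have bdd: "bdd_below (w ` \<Omega>)" using below by (intro bdd_belowI[of _ c0]) auto
  have lower: "- m \<le> w x" if "x \<in> \<Omega>" for x
    unfolding m_def using cINF_lower[OF bdd that] by simp
  have m: "m > 0" using lower[OF neg(1)] neg(2) by linarith
  have "Inf (w ` \<Omega>) < - (1 - \<delta>) * m" using mult_pos_pos[OF \<delta>(1) m] by (simp add: m_def algebra_simps)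
  then obtain x0 where x0: "x0 \<in> \<Omega>" "w x0 < - (1 - \<delta>) * m"
    using cInf_lessD[of "w ` \<Omega>"] neg(1) by auto
  define \<rho> where "\<rho> = (x0 \<bullet> e - t) / 4"
  have \<rho>: "\<rho> > 0" using \<Omega>[OF x0(1)] by (simp add: \<rho>_def)
  define a where "a = \<delta> * m / \<rho>\<^sup>2"
  have a: "a \<ge> 0" using \<delta> m by (simp add: a_def)
  obtain z where z: "z \<in> \<Omega>" "w z < - (1 - \<delta>) * m" "\<rho> \<le> z \<bullet> e - t" "z \<bullet> e - t \<le> 5 * \<rho>" "norm (z - x0) \<le> \<rho>"
    and near: "\<And>y. y \<in> ball z \<rho> \<Longrightarrow> - (a * (norm (y - z))\<^sup>2 + (2 * a) *\<^sub>R (z - x0) \<bullet> (y - z)) \<le> w y - w z"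
    using perturbed_minimum[OF lsc m \<delta>(1) _ lower x0] \<delta>(2) unfolding \<rho>_def a_def by auto
  \<comment> \<open>Half of the main term, free of \<open>A\<close>, so that it also bounds the
    infimum.\<close>
  define L where "L = m * C * \<rho> powr (- 2 * s) / 2"
  have L: "L > 0" using m C \<rho> by (simp add: L_def)
  have "L \<le> pv_integral z (\<lambda>y. (w y - w z) * kern A (y - z))" if A: "A \<in> admissible \<theta> \<Theta> e" for A
  proof -
    interpret reflected_kernel s t H n2s e "kern A" unfolding H_def by (rule reflected_kernel_kern[OF A])
    obtain l where l: "((\<lambda>\<epsilon>. LINT y:- ball z \<epsilon>|lebesgue. (w y - w z) * kern A (y - z)) \<longlongrightarrow> l) (at_right 0)"
      by (rule pv_exists[OF z(1) A])
    define J where "J = (LINT y:\<Sigma>|lebesgue. kern A (R y - z))"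
    define P where "P = \<rho> powr (- 2 * s)"
    have P: "P > 0" using \<rho> by (simp add: P_def)
    have z\<Sigma>: "z \<in> \<Sigma>" using \<Omega>[OF z(1)] by simp
    have "\<theta> powr n2s * 3 powr - n2s * unit_ball_vol (real CARD('n)) * (z \<bullet> e - t) powr (- 2 * s) \<le> J"
      unfolding J_def
      by (rule reflected_K_integral_ge[OF z\<Sigma>])
        (use admissible_kernel_bounds(2)[OF A \<theta> n2s_pos] in \<open>auto simp: kern_def\<close>)
    moreover have "(5 * \<rho>) powr (- 2 * s) \<le> (z \<bullet> e - t) powr (- 2 * s)"
      using z(3,4) \<rho> s by (intro powr_mono2') auto
    then have "\<theta> powr n2s * 3 powr - n2s * unit_ball_vol (real CARD('n)) * (5 * \<rho>) powr (- 2 * s)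
        \<le> \<theta> powr n2s * 3 powr - n2s * unit_ball_vol (real CARD('n)) * (z \<bullet> e - t) powr (- 2 * s)"
      by (intro mult_left_mono) auto
    ultimately have J: "C * P \<le> J" using \<rho> by (simp add: C_def P_def powr_mult mult.assoc)
    have "- (a * H * (LINT v:ball 0 \<rho>|lebesgue. norm (v :: real ^ 'n) powr (2 - n2s)))
        - \<delta> * m * H * (LINT v:- ball 0 \<rho>|lebesgue. norm (v :: real ^ 'n) powr - n2s)
        - (2 * w z + 2 * \<delta> * m) * J \<le> pv_integral z (\<lambda>y. (w y - w z) * kern A (y - z))"
      unfolding J_def
    proof (rule pv_ge_near_min[OF Ls _ z\<Sigma> l \<rho> z(3) a _ _ near])
      show "\<forall>y\<in>\<Sigma>. w (R y) = - w y" using antisymmetric by simp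
      show "0 \<le> \<delta> * m" using \<delta> m by simp
      \<comment> \<open>This fixes \<open>\<eta> = 2 * \<delta> * m\<close> for the linear term,
        since \<open>norm (z - x0) \<le> \<rho>\<close>.\<close>
      have "norm ((2 * a) *\<^sub>R (z - x0)) * \<rho> = 2 * a * norm (z - x0) * \<rho>" using a by simp
      also have "\<dots> \<le> 2 * a * \<rho> * \<rho>" using z(5) a \<rho> by (intro mult_right_mono mult_left_mono) auto
      also have "\<dots> = 2 * \<delta> * m" using \<rho> by (simp add: a_def power2_eq_square)
      finally show "norm ((2 * a) *\<^sub>R (z - x0)) * \<rho> \<le> 2 * \<delta> * m" .
      fix y assume y: "y \<in> \<Sigma> - ball z \<rho>"
      \<comment> \<open>Since \<open>w z\<close> exceeds the lower bound \<open>- m\<close> by less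
        than \<open>\<delta> * m\<close>, the far loss is
        \<open>\<kappa> = \<delta> * m\<close>.\<close>
      then have "- m \<le> w y" using lower[of y] outside[of y] m by (cases "y \<in> \<Omega>") auto
      then show "- (\<delta> * m) \<le> w y - w z" using z(2) by (simp add: algebra_simps)
    qed
    moreover have "a * H * (LINT v:ball 0 \<rho>|lebesgue. norm (v :: real ^ 'n) powr (2 - n2s)) \<le> \<delta> * m * H * C1 * P"
    proof -
      have "a * H * (LINT v:ball 0 \<rho>|lebesgue. norm (v :: real ^ 'n) powr (2 - n2s)) \<le> a * H * (C1 * \<rho> powr (2 - 2 * s))"
        using C1(2)[OF \<rho>] a H by (intro mult_left_mono) auto
      also have "\<rho> powr (2 - 2 * s) = \<rho>\<^sup>2 * P"
        using \<rho> powr_add[of \<rho> 2 "- 2 * s"] by (simp add: P_def)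
      also have "a * H * (C1 * (\<rho>\<^sup>2 * P)) = \<delta> * m * H * C1 * P" using \<rho> by (simp add: a_def)
      finally show ?thesis .
    qed
    moreover have "\<delta> * m * H * (LINT v:- ball 0 \<rho>|lebesgue. norm (v :: real ^ 'n) powr - n2s) \<le> \<delta> * m * H * (C2 * P)"
      using C2(2)[OF \<rho>] \<delta> m H unfolding P_def by (intro mult_left_mono) auto
    moreover have "m * (C * P) \<le> - (2 * w z + 2 * \<delta> * m) * J"
    proof -
      have "\<delta> * m \<le> 1 / 4 * m" using \<delta>(2) m by (intro mult_right_mono) auto
      then have "m \<le> - (2 * w z + 2 * \<delta> * m)" using z(2) by (simp add: algebra_simps)
      then show ?thesis using J m C P by (intro mult_mono) auto
    qed
    moreover have "\<delta> * m * H * C1 * P + \<delta> * m * H * (C2 * P) \<le> m * (C * P) / 2"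
    proof -
      have "\<delta> * m * H * C1 * P + \<delta> * m * H * (C2 * P) = \<delta> * Q * (m * P)" by (simp add: Q_def algebra_simps)
      also have "\<dots> \<le> C / 2 * (m * P)" using \<delta>(3) m P by (intro mult_right_mono) auto
      finally show ?thesis by (simp add: mult_ac)
    qed
    moreover have "L = m * (C * P) - m * (C * P) / 2" by (simp add: L_def P_def)
    ultimately show ?thesis by linarith
  qed
  then have "L \<le> Fs s \<theta> \<Theta> e w z" by (rule Fs_ge_kern)
  moreover have "0 \<le> (1 - \<delta>) * m" using \<delta>(2) m by (intro mult_nonneg_nonneg) auto
  then have "w z < 0" using z(2) unfolding mult_minus_left by linarith
  ultimately show ?thesis using that[of z] z(1) L by simp
qed

text \<open>At a zero of \<open>w\<close> the zero-order term disappears and the folded integrand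
  dominates \<open>w\<close> times \<open>reflection_gap\<close>, a positive weight independent of
  \<open>A\<close>. Its integral therefore lies below the infimum \<open>Fs\<close>, hence is
  0.\<close>

lemma AE_zero_if_Fs_nonpos:
  assumes nonneg: "\<And>x. t < x \<bullet> e \<Longrightarrow> 0 \<le> w x" and x: "x \<in> \<Omega>" "w x = 0" and Fs: "Fs s \<theta> \<Theta> e w x \<le> 0"
  shows "AE y in lebesgue. w y = 0"
proof -
  let ?\<Sigma> = "{x. t < x \<bullet> e}"
  let ?k = "\<lambda>y. reflection_gap \<theta> \<Theta> n2s e t x y"
  have wm: "w \<in> borel_measurable lebesgue" using Ls by (simp add: Ls_def)
  have km: "?k \<in> borel_measurable lebesgue"
    unfolding reflection_gap_def by (rule lebesgue_measurable_borel) measurable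
  have x\<Sigma>: "x \<in> ?\<Sigma>" using \<Omega>[OF x(1)] by simp
  have kpos: "0 < ?k y" if "y \<in> ?\<Sigma>" "y \<noteq> x" for y
    using reflection_gap_pos[OF \<theta>(1) \<Theta>_pos n2s_pos] x\<Sigma> that by auto
  have wkint: "set_integrable lebesgue (?\<Sigma> - ball x \<rho>) (\<lambda>y. w y * ?k y) \<and>
      (LINT y:?\<Sigma> - ball x \<rho>|lebesgue. w y * ?k y) \<le> pv_integral x (\<lambda>y. (w y - w x) * kern A (y - x))"
    if \<rho>: "\<rho> > 0" and A: "A \<in> admissible \<theta> \<Theta> e" for \<rho> A
  proof -
    interpret reflected_kernel s t "\<Theta> powr n2s" n2s e "kern A" by (rule reflected_kernel_kern[OF A])
    have anti: "\<forall>y\<in>\<Sigma>. w (R y) = - w y" using antisymmetric by simp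
    let ?F = "\<lambda>y. (w y - w x) * (kern A (y - x) - kern A (R y - x))"
    have F: "set_integrable lebesgue (\<Sigma> - ball x \<epsilon>) ?F" if \<epsilon>: "\<epsilon> > 0" for \<epsilon>
    proof -
      have "set_integrable lebesgue (\<Sigma> - ball x \<epsilon>) (\<lambda>y. (w y - w x) * kern A (y - x))"
        by (rule set_integrable_subset[OF increment_K_outside_ball[OF Ls \<epsilon>]]) auto
      moreover have "set_integrable lebesgue (\<Sigma> - ball x \<epsilon>) (\<lambda>y. (w y - w x) * kern A (R y - x))"
        by (rule set_integrable_subset[OF reflected_K_integrable(2)[OF x\<Sigma> Ls anti]]) auto
      ultimately show ?thesis unfolding right_diff_distrib by (rule set_integral_diff(1))
    qed
    have le: "w y * ?k y \<le> ?F y" "0 \<le> w y * ?k y" if "y \<in> \<Sigma>" "y \<noteq> x" for y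
    proof -
      have "?k y \<le> kern A (y - x) - kern A (R y - x)"
        unfolding kern_def by (rule admissible_kernel_gap[OF A \<theta> e n2s_pos]) (use x\<Sigma> that in auto)
      then show "w y * ?k y \<le> ?F y" using nonneg[of y] that x(2) by (simp add: mult_left_mono)
      show "0 \<le> w y * ?k y" using nonneg[of y] kpos[of y] that by simp
    qed
    have wk: "set_integrable lebesgue (\<Sigma> - ball x \<rho>) (\<lambda>y. w y * ?k y)"
    proof (rule set_integrable_bound[OF F[OF \<rho>]])
      show "set_borel_measurable lebesgue (\<Sigma> - ball x \<rho>) (\<lambda>y. w y * ?k y)"
        by (intro set_borel_measurableI borel_measurable_times wm km) auto
      have "norm (w y * ?k y) \<le> norm (?F y)" if "y \<in> \<Sigma> - ball x \<rho>" for y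
      proof -
        have "y \<in> \<Sigma>" "y \<noteq> x" using that \<rho> by auto
        from le[OF this] show ?thesis by simp
      qed
      then show "AE y in lebesgue. y \<in> \<Sigma> - ball x \<rho> \<longrightarrow> norm (w y * ?k y) \<le> norm (?F y)" by blast
    qed
    obtain l where l: "((\<lambda>\<epsilon>. LINT y:- ball x \<epsilon>|lebesgue. (w y - w x) * kern A (y - x)) \<longlongrightarrow> l) (at_right 0)"
      by (rule pv_exists[OF x(1) A])
    have "(LINT y:\<Sigma> - ball x \<rho>|lebesgue. w y * ?k y) \<le> pv_integral x (\<lambda>y. (w y - w x) * kern A (y - x))"
    proof (rule pv_ge[OF Ls anti x\<Sigma> l \<rho>])
      fix \<epsilon> assume \<epsilon>: "0 < \<epsilon>" "\<epsilon> < \<rho>"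
      have "(LINT y:\<Sigma> - ball x \<rho>|lebesgue. w y * ?k y) \<le> (LINT y:\<Sigma> - ball x \<rho>|lebesgue. ?F y)"
      proof (rule set_integral_mono[OF wk F[OF \<rho>]])
        fix y assume y: "y \<in> \<Sigma> - ball x \<rho>"
        then have "y \<noteq> x" using \<rho> by auto
        then show "w y * ?k y \<le> ?F y" using le(1)[of y] y by blast
      qed
      \<comment> \<open>The integrand is nonnegative, so removing a smaller ball only increases the
        integral.\<close>
      also have "\<dots> \<le> (LINT y:\<Sigma> - ball x \<epsilon>|lebesgue. ?F y)"
      proof (rule set_integral_subset_mono[OF F[OF \<epsilon>(1)]])
        show "0 \<le> ?F y" if "y \<in> \<Sigma> - ball x \<epsilon>" for y
        proof -
          have "y \<in> \<Sigma>" "y \<noteq> x" using that \<epsilon> by auto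
          from le[OF this] show ?thesis by simp
        qed
      qed (use \<epsilon> in auto)
      finally show "(LINT y:\<Sigma> - ball x \<rho>|lebesgue. w y * ?k y) \<le>
          (LINT y:\<Sigma> - ball x \<epsilon>|lebesgue. ?F y) - 2 * w x * (LINT y:\<Sigma>|lebesgue. kern A (R y - x))"
        using x(2) by simp
    qed
    with wk show ?thesis by blast
  qed
  have adm: "mat \<theta> \<in> admissible \<theta> \<Theta> e" by (rule mat_admissible) (use \<theta> e in auto)
  have zero: "AE y in lebesgue. y \<in> ?\<Sigma> - ball x \<rho> \<longrightarrow> w y = 0" if \<rho>: "\<rho> > 0" for \<rho>
  proof -
    let ?g = "\<lambda>y. indicator (?\<Sigma> - ball x \<rho>) y *\<^sub>R (w y * ?k y)"
    have g: "integrable lebesgue ?g" using wkint[OF \<rho> adm] by (simp add: set_integrable_def)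
    have pos: "0 \<le> ?g y" for y
    proof (cases "y \<in> ?\<Sigma> - ball x \<rho>")
      case True
      then have "y \<in> ?\<Sigma>" "y \<noteq> x" using \<rho> by auto
      then show ?thesis using nonneg[of y] kpos[of y] by simp
    qed simp
    have "integral\<^sup>L lebesgue ?g \<le> Fs s \<theta> \<Theta> e w x"
      by (rule Fs_ge_kern) (use wkint[OF \<rho>] in \<open>simp add: set_lebesgue_integral_def\<close>)
    moreover have "0 \<le> integral\<^sup>L lebesgue ?g" using pos by (intro Bochner_Integration.integral_nonneg)
    ultimately have "integral\<^sup>L lebesgue ?g = 0" using Fs by linarith
    then have "AE y in lebesgue. ?g y = 0"
      using integral_nonneg_eq_0_iff_AE[OF g] pos by simp
    then show ?thesis
    proof (rule AE_mp, intro AE_I2 impI)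
      fix y assume g0: "?g y = 0" and y: "y \<in> ?\<Sigma> - ball x \<rho>"
      then have "y \<in> ?\<Sigma>" "y \<noteq> x" using \<rho> by auto
      then show "w y = 0" using g0 y kpos[of y] by simp
    qed
  qed
  \<comment> \<open>Countably many radii tending to 0 exhaust the half-space without
    \<open>x\<close>, so the exceptional sets still unite to a null set.\<close>
  have "AE y in lebesgue. \<forall>j::nat. y \<in> ?\<Sigma> - ball x (1 / real (Suc j)) \<longrightarrow> w y = 0"
    unfolding AE_all_countable using zero by simp
  moreover have "AE y in lebesgue. y \<noteq> x" by (rule AE_completion[OF AE_lborel_singleton])
  ultimately have half: "AE y in lebesgue. y \<in> ?\<Sigma> \<longrightarrow> w y = 0"
  proof eventually_elim
    case (elim y)
    have "dist x y > 0" using elim(2) by simp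
    then obtain j where "1 / real (Suc j) < dist x y" using nat_approx_posE by metis
    then show ?case using spec[OF elim(1), of j] by auto
  qed
  note R = reflect_preserves_lebesgue[OF e, of t]
  \<comment> \<open>The reflection carries the null set to the other side, where antisymmetry
    applies.\<close>
  from half have "AE y in distr lebesgue lebesgue (reflect e t). y \<in> ?\<Sigma> \<longrightarrow> w y = 0" by (simp only: R(2))
  then have "AE y in lebesgue. reflect e t y \<in> ?\<Sigma> \<longrightarrow> w (reflect e t y) = 0" by (rule AE_distrD[OF R(1)])
  with half hyperplane_AE[OF e, of t] show ?thesis
  proof eventually_elim
    case (elim y)
    consider "t < y \<bullet> e" | "y \<bullet> e < t" using elim(2) by linarith
    then show ?case
    proof cases
      case 2
      then have "t < reflect e t y \<bullet> e" by (simp add: reflect_inner[OF e])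
      then show ?thesis using elim(3) antisymmetric[of "reflect e t y"] by (simp add: reflect_reflect[OF e])
    qed (use elim(1) in simp)
  qed
qed

end

text \<open>With the companion fact on \<open>reflect\<close>, this reduces the half-space below the
  hyperplane to the one above it.\<close>

lemma Fs_uminus: "Fs s \<theta> \<Theta> (- e) = Fs s \<theta> \<Theta> e"
  by (simp add: Fs_def fun_eq_iff admissible_uminus)

lemma reflect_uminus: "reflect (- e) (- t) = reflect e t"
  by (simp add: reflect_def fun_eq_iff algebra_simps)

theorem theorem2p3:
  fixes s \<theta> \<Theta> t :: real
    and e :: "real ^ 'n"
    and \<Sigma> \<Omega> :: "(real ^ 'n) set"
    and w c :: "real ^ 'n \<Rightarrow> real"
  assumes "CARD('n) \<ge> 2"
    and "0 < s" and "s < 1"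
    and "0 < \<theta>" and "\<theta> \<le> \<Theta>"
    and "norm e = 1"
    and "\<Sigma> = {x. x \<bullet> e > t} \<or> \<Sigma> = {x. x \<bullet> e < t}"
    and "open \<Omega>" and "\<Omega> \<subseteq> \<Sigma>"
    and "bounded \<Omega> \<or> Liminf (inf at_infinity (principal \<Omega>)) (\<lambda>x. ereal (w x)) \<ge> 0"
    and "w \<in> Ls s" and "w \<in> C11_loc \<Omega>"
    and "lsc_on (closure \<Omega>) w"
    and "\<forall>x\<in>\<Omega>. w x < 0 \<longrightarrow> c x \<ge> 0"
    and "\<forall>x\<in>\<Omega>. w x < 0 \<longrightarrow> Fs s \<theta> \<Theta> e w x - c x * w x \<le> 0"
    and "\<forall>x\<in>\<Sigma> - \<Omega>. w x \<ge> 0"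
    and "\<forall>x\<in>\<Sigma>. w (reflect e t x) = - w x"
  shows "(\<forall>x\<in>\<Omega>. w x \<ge> 0) \<and>
    ((\<forall>x\<in>\<Omega>. w x = 0 \<longrightarrow> Fs s \<theta> \<Theta> e w x \<le> 0) \<longrightarrow>
      (\<forall>x\<in>\<Omega>. w x > 0) \<or> (AE x in lebesgue. w x = 0))"
proof -
  obtain e' t' where e': "norm e' = 1" "\<Sigma> = {x. t' < x \<bullet> e'}" "Fs s \<theta> \<Theta> e' = Fs s \<theta> \<Theta> e"
    "reflect e' t' = reflect e t"
  proof -
    from assms(7) consider "\<Sigma> = {x. t < x \<bullet> e}" | "\<Sigma> = {x. - t < x \<bullet> (- e)}" by auto
    then show thesis
      by cases (use that[of e t] that[of "- e" "- t"] assms(6) in \<open>simp_all add: Fs_uminus reflect_uminus\<close>)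
  qed
  interpret antisymmetric_supersolution s \<theta> \<Theta> t' e' \<Omega> w
    by unfold_locales (use assms e' in auto)
  have nonneg: "\<forall>x\<in>\<Omega>. w x \<ge> 0"
  proof (rule ccontr)
    assume "\<not> (\<forall>x\<in>\<Omega>. w x \<ge> 0)"
    then obtain x1 where x1: "x1 \<in> \<Omega>" "w x1 < 0" by (auto simp: not_le)
    obtain c0 where "\<And>x. x \<in> \<Omega> \<Longrightarrow> c0 \<le> w x"
      using lsc_on_bounded_below[OF assms(13,10)] by blast
    from Fs_pos_somewhere[OF assms(13) this x1]
    obtain z where z: "z \<in> \<Omega>" "w z < 0" "0 < Fs s \<theta> \<Theta> e' w z" by blast
    \<comment> \<open>The sign of \<open>c\<close> turns the differential inequality into
      \<open>Fs \<le> 0\<close> at \<open>z\<close>, against its positivity.\<close>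
    have "c z * w z \<le> 0" using assms(14) z by (simp add: mult_nonneg_nonpos)
    moreover have "Fs s \<theta> \<Theta> e' w z \<le> c z * w z" using assms(15) z e'(3) by simp
    ultimately show False using z(3) by linarith
  qed
  have "(\<forall>x\<in>\<Omega>. w x > 0) \<or> (AE x in lebesgue. w x = 0)"
    if Fs0: "\<forall>x\<in>\<Omega>. w x = 0 \<longrightarrow> Fs s \<theta> \<Theta> e w x \<le> 0"
  proof (cases "\<forall>x\<in>\<Omega>. w x > 0")
    case False
    then obtain x where x: "x \<in> \<Omega>" "w x = 0" using nonneg by force
    have "AE y in lebesgue. w y = 0"
    proof (rule AE_zero_if_Fs_nonpos[OF _ x])
      show "0 \<le> w y" if "t' < y \<bullet> e'" for y using that nonneg outside[of y] by blast
      show "Fs s \<theta> \<Theta> e' w x \<le> 0" using Fs0 x e'(3) by simp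
    qed
    then show ?thesis ..
  qed simp
  with nonneg show ?thesis by blast
qed

end
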